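(* Let $0<s<1$, $\epsilon\in(0,1)$ and $u\in C^{2s+\epsilon,s+\epsilon}_{x,t,\mathrm{loc}}(\mathbb{R}^n\times\mathbb{R})\cap\mathcal{L}(\mathbb{R}^n\times\mathbb{R})$. Suppose that for some $(x^0,t_0)\in\mathbb{R}^n\times\mathbb{R}$, $u(x^0,t_0)=\max_{\mathbb{R}^n\times(-\infty,t_0]}u$. Then for every $r>0$, $$u(x^0,t_0)\le \frac{C_0}{C_{n,s}}r^{2s}(\partial_t-\Delta)^s u(x^0,t_0)+C_0r^{2s}\int_{-\infty}^{t_0-r^2}\int_{B_r^c(x^0)}\frac{u(y,\tau)e^{-\frac{|x^0-y|^2}{4(t_0-\tau)}}}{(t_0-\tau)^{\frac n2+1+s}}\,dy\,d\tau,$$ where $$C_0:=\left(\int_{-\infty}^{-1}\int_{B_1^c(0)}\frac{e^{\frac{|y|^2}{4\tau}}}{(-\tau)^{\frac n2+1+s}}\,dy\,d\tau\right)^{-1},$$ and moreover $$C_0r^{2s}\int_{-\infty}^{t_0-r^2}\int_{B_r^c(x^0)}\frac{e^{-\frac{|x^0-y|^2}{4(t_0-\tau)}}}{(t_0-\tau)^{\frac n2+1+s}}\,dy\,d\tau=1.$$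
   Context: For $0<s<1$, $(\partial_t-\Delta)^s u(x,t):=C_{n,s}\int_{-\infty}^{t}\int_{\mathbb{R}^n}\frac{u(x,t)-u(y,\tau)}{(t-\tau)^{\frac n2+1+s}}e^{-\frac{|x-y|^2}{4(t-\tau)}}\,dy\,d\tau$ (principal value in $y$), with $C_{n,s}=\frac{1}{(4\pi)^{n/2}|\Gamma(-s)|}$. $\mathcal{L}(\mathbb{R}^n\times\mathbb{R})$ is the set of $u\in L^1_{\mathrm{loc}}(\mathbb{R}^n\times\mathbb{R})$ with $\int_{-\infty}^t\int_{\mathbb{R}^n}\frac{|u(x,\tau)|e^{-\frac{|x|^2}{4(t-\tau)}}}{1+(t-\tau)^{\frac n2+1+s}}dx\,d\tau<\infty$ for all $t\in\mathbb{R}$. Parabolic Hölder space $C^{2\alpha,\alpha}_{x,t}$: for $0<\alpha\le\frac12$, $|u(x,t)-u(y,\tau)|\le C(|x-y|+|t-\tau|^{1/2})^{2\alpha}$; for $\frac12<\alpha\le1$, $u$ is $\alpha$-Hölder in $t$ uniformly in $x$ and $\nabla_xu$ is $(2\alpha-1)$-Hölder in $x$ uniformly in $t$ and $(\alpha-\frac12)$-Hölder in $t$ uniformly in $x$; for $\alpha>1$, $\partial_tu,D^2_xu\in C^{2\alpha-2,\alpha-1}_{x,t}$; "loc" means on compact sets. $B_r^c(x^0)=\mathbb{R}^n\setminus B_r(x^0)$. *)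

theory Defs
  imports "HOL-Analysis.Analysis"
begin

definition Cns :: "nat \<Rightarrow> real \<Rightarrow> real" where
  "Cns n s = 1 / ((4 * pi) powr (real n / 2) * \<bar>Gamma (- s)\<bar>)"

definition heat_kernel :: "nat \<Rightarrow> real \<Rightarrow> 'a::euclidean_space \<Rightarrow> real \<Rightarrow> 'a \<Rightarrow> real \<Rightarrow> real" where
  "heat_kernel n s x t y \<tau> =
     exp (- (norm (x - y))\<^sup>2 / (4 * (t - \<tau>))) / (t - \<tau>) powr (real n / 2 + 1 + s)"

text \<open>Fractional heat operator: the singular integral is understood as the limit of
  truncations removing the time layer (t - delta, t); for each tau < t the inner
  integral in y is a Lebesgue integral.\<close>
definition frac_heat :: "real \<Rightarrow> ('a::euclidean_space \<times> real \<Rightarrow> real) \<Rightarrow> 'a \<Rightarrow> real \<Rightarrow> real" where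
  "frac_heat s u x t = Cns DIM('a) s *
     Lim (at_right 0) (\<lambda>\<delta>. LINT \<tau>:{..<t - \<delta>}|lborel.
        (LINT y|lborel. (u (x, t) - u (y, \<tau>)) * heat_kernel DIM('a) s x t y \<tau>))"

definition class_L :: "real \<Rightarrow> ('a::euclidean_space \<times> real \<Rightarrow> real) \<Rightarrow> bool" where
  "class_L s u \<longleftrightarrow>
     (\<forall>K. compact K \<longrightarrow> set_integrable lborel K u) \<and>
     (\<forall>t. (\<integral>\<^sup>+ p. indicator {p. snd p < t} p *
            ennreal (\<bar>u p\<bar> * exp (- (norm (fst p))\<^sup>2 / (4 * (t - snd p)))
                     / (1 + (t - snd p) powr (real DIM('a) / 2 + 1 + s))) \<partial>lborel) < \<infinity>)"

definition phoelder_low :: "('a::euclidean_space \<times> real) set \<Rightarrow> real \<Rightarrow> ('a \<times> real \<Rightarrow> real) \<Rightarrow> bool" where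
  "phoelder_low K \<alpha> f \<longleftrightarrow> (\<exists>C. \<forall>p\<in>K. \<forall>q\<in>K.
      \<bar>f p - f q\<bar> \<le> C * (norm (fst p - fst q) + sqrt \<bar>snd p - snd q\<bar>) powr (2 * \<alpha>))"

definition phoelder_mid :: "('a::euclidean_space \<times> real) set \<Rightarrow> real \<Rightarrow> ('a \<times> real \<Rightarrow> real) \<Rightarrow> ('a \<times> real \<Rightarrow> 'a) \<Rightarrow> bool" where
  "phoelder_mid K \<alpha> f D \<longleftrightarrow> (\<exists>C. \<forall>p\<in>K. \<forall>q\<in>K.
      (fst p = fst q \<longrightarrow> \<bar>f p - f q\<bar> \<le> C * \<bar>snd p - snd q\<bar> powr \<alpha>) \<and>
      (snd p = snd q \<longrightarrow> norm (D p - D q) \<le> C * norm (fst p - fst q) powr (2 * \<alpha> - 1)) \<and>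
      (fst p = fst q \<longrightarrow> norm (D p - D q) \<le> C * \<bar>snd p - snd q\<bar> powr (\<alpha> - 1 / 2)))"

definition is_grad_x :: "('a::euclidean_space \<times> real \<Rightarrow> real) \<Rightarrow> ('a \<times> real \<Rightarrow> 'a) \<Rightarrow> bool" where
  "is_grad_x f D \<longleftrightarrow> (\<forall>x t. ((\<lambda>y. f (y, t)) has_derivative (\<lambda>h. D (x, t) \<bullet> h)) (at x))"

text \<open>C^{2\<alpha>,\<alpha>}_{x,t,loc}(R^n \<times> R), for 0 < \<alpha> < 3/2 (the range needed here).
  For \<alpha> > 1: \<partial>_t u and D^2_x u (all entries) lie in C^{2\<alpha>-2,\<alpha>-1}_loc.\<close>
definition phoelder_loc :: "real \<Rightarrow> ('a::euclidean_space \<times> real \<Rightarrow> real) \<Rightarrow> bool" where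
  "phoelder_loc \<alpha> u \<longleftrightarrow>
    (if \<alpha> \<le> 1 / 2 then (\<forall>K. compact K \<longrightarrow> phoelder_low K \<alpha> u)
     else if \<alpha> \<le> 1 then (\<exists>D. is_grad_x u D \<and> (\<forall>K. compact K \<longrightarrow> phoelder_mid K \<alpha> u D))
     else (\<exists>Ut D H. (\<forall>x t. ((\<lambda>\<tau>. u (x, \<tau>)) has_real_derivative Ut (x, t)) (at t)) \<and>
             is_grad_x u D \<and>
             (\<forall>x t. ((\<lambda>y. D (y, t)) has_derivative H (x, t)) (at x)) \<and>
             (\<forall>K. compact K \<longrightarrow> phoelder_low K (\<alpha> - 1) Ut \<and>
                 (\<forall>i\<in>Basis. \<forall>j\<in>Basis. phoelder_low K (\<alpha> - 1) (\<lambda>p. H p i \<bullet> j)))))"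

definition C0 :: "nat \<Rightarrow> real \<Rightarrow> 'a::euclidean_space itself \<Rightarrow> real" where
  "C0 n s _ = inverse (LINT \<tau>:{..<-1}|lborel.
      (LINT (y::'a):- ball 0 1|lborel. exp ((norm y)\<^sup>2 / (4 * \<tau>)) / (- \<tau>) powr (real n / 2 + 1 + s)))"

end

theory Submission
  imports Defs "HOL-Probability.Distributions"
begin

text \<open>Write \<open>M\<close> for the maximum \<open>u (x0, t0)\<close> and \<open>K\<close> for the kernel. Since \<open>(M - u) K\<close> is nonnegative in
  the past of \<open>t0\<close>, its integral over the whole past dominates its integral over the exterior
  region \<open>\<tau> < t0 - r\<^sup>2, \<bar>y - x0\<bar> \<ge> r\<close>, and the latter splits into \<open>M\<close> times the integral of \<open>K\<close>
  (equal to \<open>1 / (C0 r\<^sup>2\<^sup>s)\<close> by parabolic scaling) minus the exterior integral of \<open>u K\<close>.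
  The real work is the integrability of \<open>(M - u) K\<close>, without which the limit defining the
  operator would be a junk value. Far from \<open>(x0, t0)\<close>, \<open>K\<close> is bounded by the weight of the class
  \<open>class_L\<close> taken at the later time \<open>t0 + 2\<close>. Near \<open>(x0, t0)\<close>, the spatial gradient
  vanishes at the maximum, so the regularity of \<open>u\<close> gives \<open>M - u\<close> parabolic growth of order
  \<open>2 b\<close> with \<open>b > s\<close>.\<close>

section \<open>Gaussian integrals, power integrals and an integrable majorant\<close>

text \<open>The half-line moment \<open>gaussian_moment_0\<close>, doubled by reflection, settles
  dimension one; the Gaussian on \<open>'a\<close> is the product over \<open>Basis\<close> of
  one-dimensional ones.\<close>

lemma nn_integral_gaussian_finite:
  "(\<integral>\<^sup>+z. ennreal (exp (- (norm z)\<^sup>2)) \<partial>(lborel :: 'a::euclidean_space measure)) < \<infinity>"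
proof -
  have half: "(\<integral>\<^sup>+x. ennreal (exp (- x\<^sup>2)) * indicator {0..} x \<partial>lborel) < \<infinity>"
  proof -
    have "integrable lborel (\<lambda>x::real. indicator {0..} x *\<^sub>R exp (- x\<^sup>2))"
      using gaussian_moment_0 by (simp add: has_bochner_integral_iff)
    then have "(\<integral>\<^sup>+x. ennreal (norm (indicator {0..} (x::real) *\<^sub>R exp (- x\<^sup>2))) \<partial>lborel) < \<infinity>"
      unfolding integrable_iff_bounded by blast
    also have "(\<lambda>x::real. ennreal (norm (indicator {0..} x *\<^sub>R exp (- x\<^sup>2)))) =
        (\<lambda>x. ennreal (exp (- x\<^sup>2)) * indicator {0..} x)"
      by (auto simp: fun_eq_iff indicator_def)
    finally show ?thesis .
  qed
  \<comment> \<open>Both half-lines contain the origin, so pointwise only an inequality holds; it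
    suffices for finiteness.\<close>
  have "(\<integral>\<^sup>+x. ennreal (exp (- x\<^sup>2)) \<partial>(lborel :: real measure)) \<le>
      (\<integral>\<^sup>+x. ennreal (exp (- x\<^sup>2)) * indicator {0..} x \<partial>lborel)
      + (\<integral>\<^sup>+x. ennreal (exp (- (-x)\<^sup>2)) * indicator {0..} (- x) \<partial>lborel)"
    by (subst nn_integral_add[symmetric]) (auto intro!: nn_integral_mono simp: indicator_def)
  also have "(\<integral>\<^sup>+x. ennreal (exp (- (-x)\<^sup>2)) * indicator {0..} (- x) \<partial>lborel)
      = (\<integral>\<^sup>+x. ennreal (exp (- x\<^sup>2)) * indicator {0..} x \<partial>lborel)"
    by (subst nn_integral_real_affine[where c="-1" and t=0 and f="\<lambda>x. ennreal (exp (- x\<^sup>2)) * indicator {0..} x"])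
       auto
  also have "(\<integral>\<^sup>+x. ennreal (exp (- x\<^sup>2)) * indicator {0..} x \<partial>lborel)
      + (\<integral>\<^sup>+x. ennreal (exp (- x\<^sup>2)) * indicator {0..} x \<partial>lborel) < \<infinity>"
    using half unfolding infinity_ennreal_def ennreal_add_less_top by blast
  finally have one: "(\<integral>\<^sup>+x. ennreal (exp (- x\<^sup>2)) \<partial>(lborel :: real measure)) < \<infinity>" .
  have "(\<integral>\<^sup>+z. ennreal (exp (- (norm z)\<^sup>2)) \<partial>(lborel :: 'a measure))
      = (\<integral>\<^sup>+z. (\<Prod>b\<in>Basis. ennreal (exp (- (z \<bullet> b)\<^sup>2))) \<partial>(lborel :: 'a measure))"
  proof (intro nn_integral_cong)
    fix z :: 'a
    have "(norm z)\<^sup>2 = (\<Sum>b\<in>Basis. (z \<bullet> b)\<^sup>2)"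
      unfolding power2_norm_eq_inner by (subst euclidean_inner) (simp only: power2_eq_square)
    then have "exp (- (norm z)\<^sup>2) = (\<Prod>b\<in>Basis. exp (- (z \<bullet> b)\<^sup>2))"
      by (simp only: sum_negf[symmetric] exp_sum[OF finite_Basis])
    then show "ennreal (exp (- (norm z)\<^sup>2)) = (\<Prod>b\<in>Basis. ennreal (exp (- (z \<bullet> b)\<^sup>2)))"
      by (simp add: prod_ennreal)
  qed
  also have "\<dots> = (\<Prod>b\<in>(Basis::'a set). (\<integral>\<^sup>+x. ennreal (exp (- x\<^sup>2)) \<partial>lborel))"
    by (subst nn_integral_lborel_prod) auto
  also have "\<dots> < \<infinity>"
    using one by (simp add: power_less_top_ennreal)
  finally show ?thesis .
qed

lemma nn_integral_lborel_affine:
  fixes t :: "'a::euclidean_space"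
  assumes [measurable]: "f \<in> borel_measurable borel" and "c \<noteq> 0"
  shows "(\<integral>\<^sup>+x. f x \<partial>lborel) = ennreal (\<bar>c\<bar> ^ DIM('a)) * (\<integral>\<^sup>+x. f (t + c *\<^sub>R x) \<partial>lborel)"
  by (subst lborel_affine[OF assms(2), of t])
     (simp add: nn_integral_density nn_integral_distr nn_integral_cmult)

lemma lebesgue_integral_lborel_affine:
  fixes t :: "'a::euclidean_space" and f :: "'a \<Rightarrow> real"
  assumes [measurable]: "f \<in> borel_measurable borel" and "c \<noteq> 0"
  shows "(LINT x|lborel. f x) = \<bar>c\<bar> ^ DIM('a) * (LINT x|lborel. f (t + c *\<^sub>R x))"
  by (subst lborel_affine[OF assms(2), of t])
     (simp add: integral_density integral_distr)

lemma nn_integral_gaussian_scale: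
  fixes x :: "'a::euclidean_space"
  assumes "c > 0"
  shows "(\<integral>\<^sup>+y. ennreal (exp (- (norm (x - y))\<^sup>2 / c)) \<partial>lborel)
    = ennreal (c powr (real DIM('a) / 2)) * (\<integral>\<^sup>+z. ennreal (exp (- (norm z)\<^sup>2)) \<partial>(lborel :: 'a measure))"
proof -
  have "sqrt c ^ DIM('a) = c powr (real DIM('a) / 2)"
    using assms by (simp add: powr_half_sqrt[symmetric] powr_power)
  then show ?thesis
    using assms by (subst nn_integral_lborel_affine[where c="sqrt c" and t=x])
      (auto simp: power_mult_distrib)
qed

text \<open>Models the time factor of \<open>majorant\<close>: the exponent near 0 will be
  \<open>b - 1 - s\<close>, above -1 exactly when s < b, and the exponent at infinity
  \<open>- 1 - s\<close>.\<close>

lemma nn_integral_powr_split_finite: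
  fixes a b :: real
  assumes "a > -1" "b < -1"
  shows "(\<integral>\<^sup>+\<sigma>. ennreal (if \<sigma> \<le> 0 then 0 else if \<sigma> < 1 then \<sigma> powr a else \<sigma> powr b) \<partial>lborel) < \<infinity>"
proof -
  have "(\<lambda>x::real. x powr a) integrable_on {0<..1}"
    using assms by (intro integrable_on_powr_from_0') auto
  then have "(\<lambda>x::real. x powr a) absolutely_integrable_on {0<..1}"
    by (intro nonnegative_absolutely_integrable_1) auto
  then have 1: "set_integrable lborel {0<..1} (\<lambda>x::real. x powr a)"
    unfolding set_integrable_def by (simp add: integrable_completion)
  have "(\<lambda>x::real. x powr b) integrable_on {1..}"
    using has_integral_powr_to_inf[of b 1] assms by (auto simp: integrable_on_def)
  then have "(\<lambda>x::real. x powr b) absolutely_integrable_on {1..}"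
    by (intro nonnegative_absolutely_integrable_1) auto
  then have 2: "set_integrable lborel {1..} (\<lambda>x::real. x powr b)"
    unfolding set_integrable_def by (simp add: integrable_completion)
  have "integrable lborel (\<lambda>x::real. indicator {0<..1} x *\<^sub>R x powr a + indicator {1..} x *\<^sub>R x powr b)"
    using 1 2 unfolding set_integrable_def by (rule Bochner_Integration.integrable_add)
  then have "integrable lborel (\<lambda>\<sigma>::real. if \<sigma> \<le> 0 then 0 else if \<sigma> < 1 then \<sigma> powr a else \<sigma> powr b)"
    (is "integrable lborel ?h")
    by (rule Bochner_Integration.integrable_bound) (auto simp: indicator_def)
  moreover have "norm (?h \<sigma>) = ?h \<sigma>" for \<sigma> by simp
  ultimately show ?thesis
    unfolding integrable_iff_bounded by (simp only:)
qed

text \<open>The Gaussian width is doubled, from \<open>4 \<sigma>\<close> to \<open>8 \<sigma>\<close>: the spare half of the exponent of the heat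
  kernel absorbs the factor \<open>\<bar>x - y\<bar>\<^sup>2\<^sup>b\<close>, at the price of \<open>\<sigma>\<^sup>b\<close>.\<close>

definition majorant :: "real \<Rightarrow> real \<Rightarrow> 'a::euclidean_space \<Rightarrow> real \<Rightarrow> 'a \<times> real \<Rightarrow> real" where
  "majorant b s x t p = (let \<sigma> = t - snd p in
     (if \<sigma> \<le> 0 then 0 else if \<sigma> < 1 then \<sigma> powr (b - 1 - s) else \<sigma> powr (- 1 - s))
     * (8 * \<sigma>) powr (- (real DIM('a) / 2)) * exp (- (norm (x - fst p))\<^sup>2 / (8 * \<sigma>)))"

lemma majorant_nonneg: "0 \<le> majorant b s x t p"
  by (simp add: majorant_def Let_def)

lemma measurable_majorant [measurable]: "majorant b s x t \<in> borel_measurable borel"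
  unfolding majorant_def Let_def borel_prod[symmetric] by measurable

text \<open>Integrated first in space, the Gaussian of width \<open>8 * \<sigma>\<close> has mass
  proportional to \<open>(8 * \<sigma>) powr (n / 2)\<close>, which cancels the opposite power in
  \<open>majorant\<close>. A power integral in time remains, finite at 0 because s < b and at
  infinity because 0 < s.\<close>

lemma integrable_majorant:
  fixes x :: "'a::euclidean_space"
  assumes "s < b" "0 < s"
  shows "integrable lborel (majorant b s x t)"
proof -
  define \<phi> :: "real \<Rightarrow> real" where
    "\<phi> \<sigma> = (if \<sigma> \<le> 0 then 0 else if \<sigma> < 1 then \<sigma> powr (b - 1 - s) else \<sigma> powr (- 1 - s))" for \<sigma>
  have [measurable]: "\<phi> \<in> borel_measurable borel"
    unfolding \<phi>_def by measurable
  have \<phi>0: "0 \<le> \<phi> \<sigma>" for \<sigma> by (simp add: \<phi>_def)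
  define G where "G = (\<integral>\<^sup>+z. ennreal (exp (- (norm z)\<^sup>2)) \<partial>(lborel :: 'a measure))"
  have inner: "(\<integral>\<^sup>+y. ennreal (majorant b s x t (y, \<tau>)) \<partial>lborel) = ennreal (\<phi> (t - \<tau>)) * G" for \<tau>
  proof (cases "t - \<tau> \<le> 0")
    case True
    then show ?thesis by (simp add: majorant_def \<phi>_def)
  next
    case False
    let ?c = "8 * (t - \<tau>)"
    have c: "?c > 0" using False by simp
    have "(\<integral>\<^sup>+y. ennreal (majorant b s x t (y, \<tau>)) \<partial>lborel)
       = (\<integral>\<^sup>+y. ennreal (\<phi> (t - \<tau>) * ?c powr (- (real DIM('a) / 2))) * ennreal (exp (- (norm (x - y))\<^sup>2 / ?c)) \<partial>lborel)"
      by (intro nn_integral_cong, subst ennreal_mult[symmetric]) (auto simp: majorant_def \<phi>_def Let_def)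
    also have "\<dots> = ennreal (\<phi> (t - \<tau>) * ?c powr (- (real DIM('a) / 2))) * (ennreal (?c powr (real DIM('a) / 2)) * G)"
      unfolding G_def using nn_integral_gaussian_scale[OF c, of x] by (subst nn_integral_cmult) auto
    also have "\<dots> = ennreal (\<phi> (t - \<tau>) * ?c powr (- (real DIM('a) / 2)) * ?c powr (real DIM('a) / 2)) * G"
      by (subst (2) ennreal_mult) (auto simp: \<phi>0 mult.assoc)
    also have "\<phi> (t - \<tau>) * ?c powr (- (real DIM('a) / 2)) * ?c powr (real DIM('a) / 2) = \<phi> (t - \<tau>)"
      using False by (simp add: powr_minus)
    finally show ?thesis .
  qed
  have "(\<integral>\<^sup>+p. ennreal (majorant b s x t p) \<partial>lborel) =
      (\<integral>\<^sup>+\<tau>. (\<integral>\<^sup>+y. ennreal (majorant b s x t (y, \<tau>)) \<partial>lborel) \<partial>lborel)"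
    by (subst lborel_pair.nn_integral_snd) (simp_all add: lborel_prod)
  also have "\<dots> = (\<integral>\<^sup>+\<tau>. ennreal (\<phi> (t - \<tau>)) * G \<partial>lborel)"
    by (simp add: inner)
  also have "\<dots> = (\<integral>\<^sup>+\<tau>. ennreal (\<phi> (t - \<tau>)) \<partial>lborel) * G"
    by (rule nn_integral_multc) measurable
  also have "(\<integral>\<^sup>+\<tau>. ennreal (\<phi> (t - \<tau>)) \<partial>lborel) = (\<integral>\<^sup>+\<tau>. ennreal (\<phi> \<tau>) \<partial>lborel)"
    by (subst nn_integral_real_affine[where c="-1" and t=t and f="\<lambda>\<tau>. ennreal (\<phi> \<tau>)"]) auto
  also have "\<dots> * G < \<infinity>"
    using nn_integral_powr_split_finite[of "b - 1 - s" "-1 - s"] assms nn_integral_gaussian_finite[where 'a='a]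
    unfolding \<phi>_def G_def by (auto simp: ennreal_mult_less_top)
  finally show ?thesis
    by (auto simp: integrable_iff_bounded majorant_nonneg)
qed

section \<open>Pointwise bounds on the heat kernel\<close>

lemma powr_le_exp:
  assumes "0 \<le> (x::real)" "0 \<le> b" "b \<le> 1"
  shows "x powr b \<le> exp x"
proof (cases "x \<le> 1")
  case True
  then have "x powr b \<le> 1" using assms by (intro powr_le1) auto
  then show ?thesis using assms by (meson one_le_exp_iff order_trans)
next
  case False
  then have "x powr b \<le> x powr 1" using assms by (intro powr_mono) auto
  also have "x powr 1 = x" using False by simp
  also have "x \<le> exp x" using exp_ge_add_one_self[of x] by linarith
  finally show ?thesis .
qed

text \<open>Brings \<open>majorant\<close> to the shape of the heat kernel, over the same power of
  \<open>t - \<tau>\<close>; the prefactor removes the 8 from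
  \<open>(8 * \<sigma>) powr _\<close>.\<close>

lemma majorant_eq:
  fixes x :: "'a::euclidean_space"
  assumes "\<tau> < t"
  shows "8 powr (real DIM('a) / 2) * majorant b s x t (y, \<tau>) =
    (if t - \<tau> < 1 then (t - \<tau>) powr b else 1) *
    (exp (- (norm (x - y))\<^sup>2 / (8 * (t - \<tau>))) / (t - \<tau>) powr (real DIM('a) / 2 + 1 + s))"
proof -
  define \<sigma> where "\<sigma> = t - \<tau>"
  have \<sigma>: "\<sigma> > 0" using assms by (simp add: \<sigma>_def)
  have *: "8 powr h * ((if \<sigma> < 1 then \<sigma> powr (b - 1 - s) else \<sigma> powr (- 1 - s)) * (8 * \<sigma>) powr (- h))
      = (if \<sigma> < 1 then \<sigma> powr b else 1) / \<sigma> powr (h + 1 + s)" for h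
    using \<sigma> by (simp add: powr_mult powr_minus powr_diff powr_add field_simps)
  show ?thesis
    using \<sigma> *[of "real DIM('a) / 2"] by (simp add: majorant_def Let_def flip: \<sigma>_def mult.assoc)
qed

text \<open>With \<open>X = (norm (x - y))\<^sup>2 / (8 * \<sigma>)\<close> the kernel carries
  \<open>exp (- X)\<close> twice. One factor absorbs the spatial growth, which is
  \<open>(8 * \<sigma> * X) powr b\<close>, through \<open>X powr b \<le> exp X\<close>; the other
  is the Gaussian of \<open>majorant\<close>.\<close>

lemma growth_heat_kernel_le_majorant:
  fixes x :: "'a::euclidean_space"
  assumes "t - 1 < \<tau>" "\<tau> < t" "0 \<le> b" "b \<le> 1"
  shows "(norm (x - y) powr (2 * b) + (t - \<tau>) powr b) * heat_kernel DIM('a) s x t y \<tau>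
    \<le> (8 powr b + 1) * 8 powr (real DIM('a) / 2) * majorant b s x t (y, \<tau>)"
proof -
  define \<sigma> where "\<sigma> = t - \<tau>"
  define X where "X = (norm (x - y))\<^sup>2 / (8 * \<sigma>)"
  define P where "P = \<sigma> powr (real DIM('a) / 2 + 1 + s)"
  have \<sigma>: "\<sigma> > 0" "\<sigma> < 1" using assms by (simp_all add: \<sigma>_def)
  have X: "X \<ge> 0" using \<sigma> by (simp add: X_def)
  have P: "P > 0" using \<sigma> by (simp add: P_def)
  have K: "heat_kernel DIM('a) s x t y \<tau> = exp (- X) * exp (- X) / P"
    using \<sigma> by (simp add: heat_kernel_def X_def P_def flip: \<sigma>_def exp_add)
  have "norm (x - y) powr (2 * b) = ((norm (x - y))\<^sup>2) powr b"
    using powr_powr[of "norm (x - y)" 2 b] by simp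
  also have "\<dots> = (8 * \<sigma> * X) powr b" using \<sigma> by (simp add: X_def)
  also have "\<dots> = 8 powr b * \<sigma> powr b * X powr b" using \<sigma> X by (simp add: powr_mult)
  also have "\<dots> \<le> 8 powr b * \<sigma> powr b * exp X"
    using powr_le_exp[OF X] assms by (intro mult_left_mono) auto
  finally have 1: "norm (x - y) powr (2 * b) * exp (- X) \<le> 8 powr b * \<sigma> powr b"
    by (simp add: exp_minus field_simps)
  have 2: "\<sigma> powr b * exp (- X) \<le> \<sigma> powr b"
    using X by (simp add: mult_left_le)
  have "(norm (x - y) powr (2 * b) + \<sigma> powr b) * exp (- X) * (exp (- X) / P)
     \<le> ((8 powr b + 1) * \<sigma> powr b) * (exp (- X) / P)"
    using 1 2 P by (intro mult_right_mono) (auto simp: algebra_simps)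
  moreover have "8 powr (real DIM('a) / 2) * majorant b s x t (y, \<tau>) = \<sigma> powr b * (exp (- X) / P)"
    using majorant_eq[of \<tau> t b s x y] assms \<sigma> by (simp add: X_def P_def flip: \<sigma>_def)
  ultimately show ?thesis
    unfolding K by (simp add: mult.assoc flip: \<sigma>_def)
qed

lemma heat_kernel_nonneg: "0 \<le> heat_kernel n s x t y \<tau>"
  by (simp add: heat_kernel_def)

text \<open>For \<open>1 \<le> t - \<tau>\<close> it is enough to halve the exponent. At shorter
  times the distance is at least \<open>\<rho>\<close>, so \<open>\<rho> powr (2 * b)\<close> is
  below the growth factor of \<open>growth_heat_kernel_le_majorant\<close>, and one divides by
  it.\<close>

lemma heat_kernel_le_majorant_far:
  fixes x :: "'a::euclidean_space"
  assumes "0 \<le> b" "b \<le> 1" "0 < \<rho>"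
  obtains C where "C \<ge> 0" "\<And>y \<tau>. \<tau> < t \<Longrightarrow> 1 \<le> t - \<tau> \<or> \<rho> \<le> norm (x - y) \<Longrightarrow>
    heat_kernel DIM('a) s x t y \<tau> \<le> C * majorant b s x t (y, \<tau>)"
proof
  let ?A = "8 powr (real DIM('a) / 2)" and ?B = "(8 powr b + 1) * 8 powr (real DIM('a) / 2) / \<rho> powr (2 * b)"
  show "?A + ?B \<ge> 0" by (intro add_nonneg_nonneg) auto
  fix y \<tau> assume h: "\<tau> < t" "1 \<le> t - \<tau> \<or> \<rho> \<le> norm (x - y)"
  have m: "0 \<le> majorant b s x t (y, \<tau>)" by (rule majorant_nonneg)
  show "heat_kernel DIM('a) s x t y \<tau> \<le> (?A + ?B) * majorant b s x t (y, \<tau>)"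
  proof (cases "1 \<le> t - \<tau>")
    case True
    have "heat_kernel DIM('a) s x t y \<tau> \<le>
        exp (- (norm (x - y))\<^sup>2 / (8 * (t - \<tau>))) / (t - \<tau>) powr (real DIM('a) / 2 + 1 + s)"
      unfolding heat_kernel_def using h by (intro divide_right_mono) (auto intro!: divide_left_mono)
    also have "\<dots> = ?A * majorant b s x t (y, \<tau>)"
      using majorant_eq[OF h(1), of b s x y] True by simp
    also have "\<dots> \<le> (?A + ?B) * majorant b s x t (y, \<tau>)"
      using m by (intro mult_right_mono) auto
    finally show ?thesis .
  next
    case False
    then have \<rho>: "\<rho> \<le> norm (x - y)" using h by simp
    have "\<rho> powr (2 * b) * heat_kernel DIM('a) s x t y \<tau>
        \<le> (norm (x - y) powr (2 * b) + (t - \<tau>) powr b) * heat_kernel DIM('a) s x t y \<tau>"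
      using \<rho> assms by (intro mult_right_mono heat_kernel_nonneg order_trans[OF powr_mono2[of "2*b" \<rho> "norm (x-y)"]]) auto
    also have "\<dots> \<le> (8 powr b + 1) * 8 powr (real DIM('a) / 2) * majorant b s x t (y, \<tau>)"
      using False h assms by (intro growth_heat_kernel_le_majorant) auto
    finally have "heat_kernel DIM('a) s x t y \<tau> \<le> ?B * majorant b s x t (y, \<tau>)"
      using assms by (simp add: field_simps)
    also have "\<dots> \<le> (?A + ?B) * majorant b s x t (y, \<tau>)"
      using m by (intro mult_right_mono) auto
    finally show ?thesis .
  qed
qed

text \<open>Cauchy-Schwarz in Engel form: after clearing denominators the difference of the two
  sides is the square of \<open>h * p - a * q\<close>.\<close>

lemma sq_sum_divide_le:
  fixes p q a h :: real
  assumes "0 < a" "0 < h"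
  shows "(p + q)\<^sup>2 / (a + h) \<le> p\<^sup>2 / a + q\<^sup>2 / h"
proof -
  have "(p\<^sup>2 * h + q\<^sup>2 * a) * (a + h) - (p + q)\<^sup>2 * (a * h) = (h * p - a * q)\<^sup>2"
    by algebra
  then have "(p + q)\<^sup>2 * (a * h) \<le> (p\<^sup>2 * h + q\<^sup>2 * a) * (a + h)"
    using zero_le_power2[of "h * p - a * q"] by linarith
  then have "(p + q)\<^sup>2 / (a + h) \<le> (p\<^sup>2 * h + q\<^sup>2 * a) / (a * h)"
    using assms by (simp add: pos_divide_le_eq pos_le_divide_eq)
  also have "\<dots> = p\<^sup>2 / a + q\<^sup>2 / h"
    using assms by (simp add: add_frac_eq)
  finally show ?thesis .
qed

text \<open>Recentres a Gaussian from \<open>x\<close> to the origin, the only centre allowed in \<open>class_L\<close>, in exchange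
  for an additional time \<open>h\<close>.\<close>

lemma norm_sq_shift_le:
  fixes x y :: "'a::euclidean_space"
  assumes "0 < a" "0 < h"
  shows "(norm y)\<^sup>2 / (a + h) \<le> (norm (x - y))\<^sup>2 / a + (norm x)\<^sup>2 / h"
proof -
  have "norm y \<le> norm (x - y) + norm x"
    using norm_triangle_ineq4[of x "x - y"] by simp
  then have "(norm y)\<^sup>2 / (a + h) \<le> (norm (x - y) + norm x)\<^sup>2 / (a + h)"
    using assms by (intro divide_right_mono power_mono) auto
  also have "\<dots> \<le> (norm (x - y))\<^sup>2 / a + (norm x)\<^sup>2 / h"
    using assms by (rule sq_sum_divide_le)
  finally show ?thesis .
qed

text \<open>This is \<open>z \<le> exp z\<close> at \<open>z = 1 / (8 * a * \<sigma>)\<close>,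
  raised to the power \<open>a\<close>. It serves where \<open>norm (x - y) \<ge> 1\<close>: there
  the Gaussian beats the singular power of time.\<close>

lemma exp_inverse_powr_bounded:
  assumes "0 < \<sigma>" "0 < (a::real)"
  shows "exp (- 1 / (8 * \<sigma>)) / \<sigma> powr a \<le> (8 * a) powr a"
proof -
  define E where "E = exp (1 / (8 * \<sigma>))"
  have "1 / (8 * a * \<sigma>) \<le> exp (1 / (8 * a * \<sigma>))"
    using exp_ge_add_one_self[of "1 / (8 * a * \<sigma>)"] by linarith
  then have "(1 / (8 * a * \<sigma>)) powr a \<le> exp (1 / (8 * a * \<sigma>)) powr a"
    using assms by (intro powr_mono2) auto
  also have "exp (1 / (8 * a * \<sigma>)) powr a = E"
    using assms by (simp add: exp_powr_real E_def)
  also have "(1 / (8 * a * \<sigma>)) powr a = 1 / ((8 * a) powr a * \<sigma> powr a)"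
    using assms by (simp add: powr_divide powr_mult)
  finally have 1: "1 / ((8 * a) powr a * \<sigma> powr a) \<le> E" .
  have aux: "1 / E / S \<le> Q" if "1 / (Q * S) \<le> E" "0 < Q" "0 < S" "0 < E" for E Q S :: real
    using that by (simp add: field_simps)
  have "1 / E / \<sigma> powr a \<le> (8 * a) powr a"
    using 1 by (rule aux) (use assms in \<open>auto simp: E_def\<close>)
  then show ?thesis by (simp add: E_def exp_minus inverse_eq_divide)
qed

text \<open>The additional time 2 pays for moving the centre of the Gaussian from \<open>x\<close>
  to 0. For \<sigma> \<ge> 1 the two powers of time are comparable. For \<sigma> < 1 half of the
  exponent is recentred, and the other half, using \<open>1 \<le> norm (x - y)\<close>, bounds the
  singular power.\<close>

lemma heat_kernel_le_class_weight:
  fixes x :: "'a::euclidean_space"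
  assumes "0 < s"
  obtains C where "C \<ge> 0" "\<And>y \<tau>. \<tau> < t \<Longrightarrow> 1 \<le> t - \<tau> \<or> 1 \<le> norm (x - y) \<Longrightarrow>
    heat_kernel DIM('a) s x t y \<tau> \<le> C * (exp (- (norm y)\<^sup>2 / (4 * (t + 2 - \<tau>)))
                     / (1 + (t + 2 - \<tau>) powr (real DIM('a) / 2 + 1 + s)))"
proof
  define a where "a = real DIM('a) / 2 + 1 + s"
  have a: "a > 0" using assms by (simp add: a_def add_pos_pos)
  define N where "N = exp ((norm x)\<^sup>2 / 4)"
  let ?A = "N * (1 + 3 powr a)" and ?B = "N * (8 * a) powr a * (1 + 3 powr a)"
  have N: "N > 0" by (simp add: N_def)
  show "?A + ?B \<ge> 0" using N by (intro add_nonneg_nonneg) auto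
  fix y \<tau> assume h: "\<tau> < t" "1 \<le> t - \<tau> \<or> 1 \<le> norm (x - y)"
  define \<sigma> where "\<sigma> = t - \<tau>"
  have \<sigma>: "\<sigma> > 0" using h by (simp add: \<sigma>_def)
  let ?E = "exp (- (norm y)\<^sup>2 / (4 * (\<sigma> + 2)))" and ?D = "1 + (\<sigma> + 2) powr a"
  have quarter: "- A / (4 * c) = - (A / c) / 4" for A c :: real by simp
  \<comment> \<open>In \<open>aux1\<close> and \<open>aux2\<close>, \<open>Y\<close> stands for
    \<open>(norm y)\<^sup>2 / (\<sigma> + 2)\<close>, \<open>Z\<close> for
    \<open>(norm (x - y))\<^sup>2 / \<sigma>\<close>, \<open>W\<close> for
    \<open>1 / (2 * \<sigma>)\<close>, and the local \<open>N\<close> for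
    \<open>(norm x)\<^sup>2\<close>, not for the constant defined above.\<close>
  have aux1: "- Z / 4 \<le> N / 4 + - Y / 4" if "Y \<le> Z + N / 2" "N / 2 \<le> N" for Y Z N :: real
    using that by linarith
  have aux3: "k / S \<le> M * T * (E / D)" if "k * D \<le> (M * E) * (T * S)" "S > 0" "D > 0" for k S M T E D :: real
    using that by (simp add: field_simps)
  have aux2: "- Z / 4 \<le> - W / 4 + (N / 4 + - Y / 4)" if "Y \<le> Z / 2 + N" "W \<le> Z / 2" for W Y Z N :: real
    using that by linarith
  have D: "?D > 0" by (simp add: add_pos_nonneg)
  have "exp (- (norm (x - y))\<^sup>2 / (4 * \<sigma>)) / \<sigma> powr a \<le> (?A + ?B) * (?E / ?D)"
  proof (cases "1 \<le> \<sigma>")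
    case True
    have "(norm y)\<^sup>2 / (\<sigma> + 2) \<le> (norm (x - y))\<^sup>2 / \<sigma> + (norm x)\<^sup>2 / 2"
      using norm_sq_shift_le[of \<sigma> 2 y x] \<sigma> by simp
    moreover have "(norm x)\<^sup>2 / 2 \<le> (norm x)\<^sup>2" by simp
    ultimately have "- ((norm (x - y))\<^sup>2 / \<sigma>) / 4 \<le> (norm x)\<^sup>2 / 4 + - ((norm y)\<^sup>2 / (\<sigma> + 2)) / 4"
      by (rule aux1)
    then have "- (norm (x - y))\<^sup>2 / (4 * \<sigma>) \<le> (norm x)\<^sup>2 / 4 + - (norm y)\<^sup>2 / (4 * (\<sigma> + 2))"
      unfolding quarter .
    then have 1: "exp (- (norm (x - y))\<^sup>2 / (4 * \<sigma>)) \<le> N * ?E"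
      by (simp add: N_def flip: exp_add)
    \<comment> \<open>For \<sigma> \<ge> 1 one has \<open>\<sigma> + 2 \<le> 3 * \<sigma>\<close>;
      hence the factor \<open>1 + 3 powr a\<close> in \<open>?A\<close>.\<close>
    have "?D \<le> \<sigma> powr a + (3 * \<sigma>) powr a"
      using True a by (intro add_mono powr_mono2 ge_one_powr_ge_zero) auto
    then have 2: "?D \<le> (1 + 3 powr a) * \<sigma> powr a"
      using \<sigma> by (simp add: powr_mult algebra_simps)
    have "exp (- (norm (x - y))\<^sup>2 / (4 * \<sigma>)) * ?D \<le> (N * ?E) * ((1 + 3 powr a) * \<sigma> powr a)"
      using 1 2 N D by (intro mult_mono) auto
    then have "exp (- (norm (x - y))\<^sup>2 / (4 * \<sigma>)) / \<sigma> powr a \<le> ?A * (?E / ?D)"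
      using \<sigma> D by (intro aux3) auto
    also have "\<dots> \<le> (?A + ?B) * (?E / ?D)"
      using N D by (intro mult_right_mono) auto
    finally show ?thesis .
  next
    case False
    then have z: "1 \<le> norm (x - y)" using h by (simp add: \<sigma>_def)
    \<comment> \<open>Recentring with width \<open>2 * \<sigma>\<close> and additional time 1 costs
      only half of \<open>(norm (x - y))\<^sup>2 / \<sigma>\<close>; the other half is kept for
      \<open>e2\<close>. The sum \<open>2 * \<sigma> + 1\<close> fits below
      \<open>\<sigma> + 2\<close> since \<sigma> < 1.\<close>
    have "(norm y)\<^sup>2 / (\<sigma> + 2) \<le> (norm y)\<^sup>2 / (2 * \<sigma> + 1)"
      using False \<sigma> by (intro divide_left_mono) auto
    also have "\<dots> \<le> (norm (x - y))\<^sup>2 / (2 * \<sigma>) + (norm x)\<^sup>2"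
      using norm_sq_shift_le[of "2 * \<sigma>" 1 y x] \<sigma> by simp
    finally have e1: "(norm y)\<^sup>2 / (\<sigma> + 2) \<le> (norm (x - y))\<^sup>2 / (2 * \<sigma>) + (norm x)\<^sup>2" .
    have e2: "1 / (2 * \<sigma>) \<le> (norm (x - y))\<^sup>2 / (2 * \<sigma>)"
      using z \<sigma> by (intro divide_right_mono) auto
    have e3: "(norm (x - y))\<^sup>2 / (2 * \<sigma>) = (norm (x - y))\<^sup>2 / \<sigma> / 2" by simp
    have "- ((norm (x - y))\<^sup>2 / \<sigma>) / 4 \<le> - (1 / (2 * \<sigma>)) / 4 + ((norm x)\<^sup>2 / 4 + - ((norm y)\<^sup>2 / (\<sigma> + 2)) / 4)"
      using e1 e2 unfolding e3 by (rule aux2)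
    moreover have "- 1 / (8 * \<sigma>) = - (1 / (2 * \<sigma>)) / 4" by simp
    ultimately have "- (norm (x - y))\<^sup>2 / (4 * \<sigma>) \<le> - 1 / (8 * \<sigma>) + ((norm x)\<^sup>2 / 4 + - (norm y)\<^sup>2 / (4 * (\<sigma> + 2)))"
      unfolding quarter by simp
    then have "exp (- (norm (x - y))\<^sup>2 / (4 * \<sigma>)) \<le> exp (- 1 / (8 * \<sigma>)) * (N * ?E)"
      by (simp add: N_def flip: exp_add)
    then have "exp (- (norm (x - y))\<^sup>2 / (4 * \<sigma>)) / \<sigma> powr a \<le> (exp (- 1 / (8 * \<sigma>)) / \<sigma> powr a) * (N * ?E)"
      using \<sigma> by (subst times_divide_eq_left) (intro divide_right_mono, auto)
    also have "\<dots> \<le> (8 * a) powr a * (N * ?E)"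
      using exp_inverse_powr_bounded[OF \<sigma> a] N by (intro mult_right_mono) auto
    also have "\<dots> = (8 * a) powr a * (N * ?E) / ?D * ?D"
      using D by simp
    also have "\<dots> \<le> (8 * a) powr a * (N * ?E) / ?D * (1 + 3 powr a)"
      using False \<sigma> a N D by (intro mult_left_mono add_mono powr_mono2) auto
    also have "\<dots> = ?B * (?E / ?D)" by simp
    also have "\<dots> \<le> (?A + ?B) * (?E / ?D)"
      using N D by (intro mult_right_mono) auto
    finally show ?thesis .
  qed
  note le = this
  have e: "t + 2 - \<tau> = \<sigma> + 2" by (simp add: \<sigma>_def)
  show "heat_kernel DIM('a) s x t y \<tau> \<le> (?A + ?B) * (exp (- (norm y)\<^sup>2 / (4 * (t + 2 - \<tau>)))
                     / (1 + (t + 2 - \<tau>) powr (real DIM('a) / 2 + 1 + s)))"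
    unfolding heat_kernel_def e a_def[symmetric] \<sigma>_def[symmetric] by (rule le)
qed

section \<open>Parabolic growth at the maximum\<close>

text \<open>Compare with the vertex \<open>(x0, t0)\<close>: the parabolic distance to it is at most
  2 on the unit cylinder.\<close>

lemma phoelder_low_bounded:
  assumes "phoelder_low (cball x0 1 \<times> {t0 - 1..t0}) \<alpha> f" "\<alpha> > 0"
  obtains B where "B \<ge> 0"
    "\<And>y \<tau>. norm (y - x0) \<le> 1 \<Longrightarrow> t0 - 1 \<le> \<tau> \<Longrightarrow> \<tau> \<le> t0 \<Longrightarrow> \<bar>f (y, \<tau>)\<bar> \<le> B"
proof -
  obtain C where C: "\<bar>f p - f q\<bar> \<le> C * (norm (fst p - fst q) + sqrt \<bar>snd p - snd q\<bar>) powr (2 * \<alpha>)"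
    if "p \<in> cball x0 1 \<times> {t0 - 1..t0}" "q \<in> cball x0 1 \<times> {t0 - 1..t0}" for p q
    using assms(1) unfolding phoelder_low_def by blast
  show ?thesis
  proof (rule that[of "\<bar>f (x0, t0)\<bar> + \<bar>C\<bar> * 2 powr (2 * \<alpha>)"])
    fix y \<tau> assume h: "norm (y - x0) \<le> 1" "t0 - 1 \<le> \<tau>" "\<tau> \<le> t0"
    have "\<bar>f (y, \<tau>) - f (x0, t0)\<bar> \<le> C * (norm (y - x0) + sqrt \<bar>\<tau> - t0\<bar>) powr (2 * \<alpha>)"
      using C[of "(y, \<tau>)" "(x0, t0)"] h by (simp add: dist_norm norm_minus_commute)
    also have "\<dots> \<le> \<bar>C\<bar> * 2 powr (2 * \<alpha>)"
    proof (intro mult_mono powr_mono2)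
      have "sqrt \<bar>\<tau> - t0\<bar> \<le> 1" using h by simp
      then show "norm (y - x0) + sqrt \<bar>\<tau> - t0\<bar> \<le> 2" using h by linarith
    qed (use assms in auto)
    finally show "\<bar>f (y, \<tau>)\<bar> \<le> \<bar>f (x0, t0)\<bar> + \<bar>C\<bar> * 2 powr (2 * \<alpha>)" by linarith
  qed auto
qed

text \<open>\<open>phoelder_loc\<close> controls the second derivative only entry by entry; this
  turns entry bounds into an operator bound, hence into a Lipschitz constant for the
  gradient.\<close>

lemma norm_linear_le_of_entries:
  fixes L :: "'a::euclidean_space \<Rightarrow> 'a"
  assumes L: "linear L" and B: "\<And>i j. i \<in> Basis \<Longrightarrow> j \<in> Basis \<Longrightarrow> \<bar>L i \<bullet> j\<bar> \<le> B i j"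
  shows "norm (L h) \<le> (\<Sum>i\<in>Basis. \<Sum>j\<in>Basis. B i j) * norm h"
proof -
  have "L h = L (\<Sum>i\<in>Basis. (h \<bullet> i) *\<^sub>R i)"
    by (simp add: euclidean_representation)
  then have "norm (L h) = norm (\<Sum>i\<in>Basis. (h \<bullet> i) *\<^sub>R L i)"
    using L by (simp add: linear_sum linear_scale)
  also have "\<dots> \<le> (\<Sum>i\<in>Basis. norm h * (\<Sum>j\<in>Basis. B i j))"
  proof (rule sum_norm_le)
    fix i :: 'a assume i: "i \<in> Basis"
    have "norm (L i) \<le> (\<Sum>j\<in>Basis. \<bar>L i \<bullet> j\<bar>)" by (rule norm_le_l1)
    also have "\<dots> \<le> (\<Sum>j\<in>Basis. B i j)" by (intro sum_mono B i)
    finally show "norm ((h \<bullet> i) *\<^sub>R L i) \<le> norm h * (\<Sum>j\<in>Basis. B i j)"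
      using Basis_le_norm[OF i, of h] by (auto intro!: mult_mono)
  qed
  also have "\<dots> = (\<Sum>i\<in>Basis. \<Sum>j\<in>Basis. B i j) * norm h"
    by (simp add: sum_distrib_left mult.commute)
  finally show ?thesis .
qed

text \<open>Mean value inequality on the segment from \<open>x0\<close> to \<open>y\<close>: since c
  \<ge> 1, the gradient bound is largest at the endpoint \<open>y\<close>.\<close>

lemma gradient_growth:
  fixes g :: "'a::euclidean_space \<Rightarrow> real"
  assumes g: "\<And>y. (g has_derivative (\<lambda>h. D y \<bullet> h)) (at y)"
    and D: "\<And>y. norm (y - x0) \<le> 1 \<Longrightarrow> norm (D y) \<le> C * norm (y - x0) powr (c - 1)"
    and c: "c \<ge> 1" and y: "norm (y - x0) \<le> 1" and C: "C \<ge> 0"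
  shows "\<bar>g y - g x0\<bar> \<le> C * norm (y - x0) powr c"
proof -
  let ?B = "C * norm (y - x0) powr (c - 1)"
  have "norm (g y - g x0) \<le> ?B * norm (y - x0)"
  proof (rule differentiable_bound[where S="closed_segment x0 y"])
    fix z assume "z \<in> closed_segment x0 y"
    then have z: "norm (z - x0) \<le> norm (y - x0)"
      by (rule segment_bound1)
    have "norm (D z) \<le> C * norm (z - x0) powr (c - 1)" using D z y by simp
    also have "\<dots> \<le> ?B" using z c C by (intro mult_left_mono powr_mono2) auto
    finally show "onorm (\<lambda>h. D z \<bullet> h) \<le> ?B"
      unfolding real_norm_def
      by (intro onorm_le order_trans[OF Cauchy_Schwarz_ineq2 mult_right_mono, folded real_norm_def]) auto
    show "(g has_derivative (\<lambda>h. D z \<bullet> h)) (at z within closed_segment x0 y)"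
      using g has_derivative_at_withinI by blast
  qed auto
  also have "\<dots> = C * norm (y - x0) powr c"
    by (cases "y = x0") (auto simp: powr_diff)
  finally show ?thesis by simp
qed

text \<open>Fermat's criterion on the time slice \<open>t0\<close>, where \<open>x0\<close> is a
  maximum over the whole space.\<close>

lemma is_grad_x_zero_at_max:
  assumes "is_grad_x u D" "\<forall>y \<tau>. \<tau> \<le> t0 \<longrightarrow> u (y, \<tau>) \<le> u (x0, t0)"
  shows "D (x0, t0) = 0"
proof -
  have "(\<lambda>h. D (x0, t0) \<bullet> h) = (\<lambda>h. 0)"
    using assms unfolding is_grad_x_def
    by (intro differential_zero_maxmin[where f="\<lambda>y. u (y, t0)" and x=x0 and S=UNIV]) auto
  then show ?thesis by (metis inner_eq_zero_iff)
qed

text \<open>For \<alpha> \<le> 1/2 this is the Hoelder bound itself. Above 1/2 the gradient vanishes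
  at the maximum, and integrating its modulus of continuity raises the spatial order by one. For
  \<alpha> > 1 the bounds on \<open>Ut\<close> and \<open>H\<close> give order 1 in time and 2 in
  space, hence the cap \<open>min \<alpha> 1\<close>.\<close>

lemma phoelder_loc_growth_at_max:
  fixes u :: "'a::euclidean_space \<times> real \<Rightarrow> real"
  assumes reg: "phoelder_loc \<alpha> u" and \<alpha>: "0 < \<alpha>"
    and max: "\<forall>y \<tau>. \<tau> \<le> t0 \<longrightarrow> u (y, \<tau>) \<le> u (x0, t0)"
  obtains C where "C \<ge> 0"
    "\<And>y \<tau>. norm (x0 - y) \<le> 1 \<Longrightarrow> t0 - 1 \<le> \<tau> \<Longrightarrow> \<tau> \<le> t0 \<Longrightarrow>
      \<bar>u (x0, t0) - u (y, \<tau>)\<bar> \<le> C * (norm (x0 - y) powr (2 * min \<alpha> 1) + (t0 - \<tau>) powr (min \<alpha> 1))"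
proof -
  let ?K = "cball x0 1 \<times> {t0 - 1..t0}"
  note growthI = that
  have K: "compact ?K" by (intro compact_Times) auto
  \<comment> \<open>The comparison passes through \<open>(y, t0)\<close>: the gradient is known to
    vanish only at \<open>(x0, t0)\<close>, so the space step stays on the slice \<open>t0\<close>
    and the time step is made at fixed \<open>y\<close>.\<close>
  have combine: thesis
    if space: "\<And>y. norm (y - x0) \<le> 1 \<Longrightarrow> \<bar>u (y, t0) - u (x0, t0)\<bar> \<le> A * norm (y - x0) powr (2 * min \<alpha> 1)"
      and time: "\<And>y \<tau>. norm (y - x0) \<le> 1 \<Longrightarrow> t0 - 1 \<le> \<tau> \<Longrightarrow> \<tau> \<le> t0 \<Longrightarrow>
          \<bar>u (y, t0) - u (y, \<tau>)\<bar> \<le> B * (t0 - \<tau>) powr (min \<alpha> 1)" for A B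
  proof (rule growthI[of "\<bar>A\<bar> + \<bar>B\<bar>"])
    fix y \<tau> assume h: "norm (x0 - y) \<le> 1" "t0 - 1 \<le> \<tau>" "\<tau> \<le> t0"
    let ?X = "norm (x0 - y) powr (2 * min \<alpha> 1)" and ?T = "(t0 - \<tau>) powr (min \<alpha> 1)"
    have "\<bar>u (x0, t0) - u (y, \<tau>)\<bar> \<le> A * ?X + B * ?T"
      using space[of y] time[of y \<tau>] h by (simp add: norm_minus_commute)
    also have "\<dots> \<le> (\<bar>A\<bar> + \<bar>B\<bar>) * ?X + (\<bar>A\<bar> + \<bar>B\<bar>) * ?T"
      by (intro add_mono mult_right_mono) auto
    finally show "\<bar>u (x0, t0) - u (y, \<tau>)\<bar> \<le> (\<bar>A\<bar> + \<bar>B\<bar>) * (?X + ?T)"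
      by (simp add: distrib_left)
  qed auto
  consider "\<alpha> \<le> 1 / 2" | "1 / 2 < \<alpha>" "\<alpha> \<le> 1" | "1 < \<alpha>" by linarith
  then show thesis
  proof cases
    case 1
    then have "phoelder_low ?K \<alpha> u" using reg K unfolding phoelder_loc_def by auto
    then obtain C where C: "\<bar>u p - u q\<bar> \<le> C * (norm (fst p - fst q) + sqrt \<bar>snd p - snd q\<bar>) powr (2 * \<alpha>)"
      if "p \<in> ?K" "q \<in> ?K" for p q
      unfolding phoelder_low_def by blast
    show thesis
    proof (rule combine[of C C])
      fix y assume "norm (y - x0) \<le> 1"
      then show "\<bar>u (y, t0) - u (x0, t0)\<bar> \<le> C * norm (y - x0) powr (2 * min \<alpha> 1)"
        using C[of "(y, t0)" "(x0, t0)"] 1 by (simp add: dist_norm norm_minus_commute)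
    next
      fix y \<tau> assume h: "norm (y - x0) \<le> 1" "t0 - 1 \<le> \<tau>" "\<tau> \<le> t0"
      have "sqrt (t0 - \<tau>) powr (2 * \<alpha>) = (t0 - \<tau>) powr \<alpha>"
        using h by (simp add: powr_powr flip: powr_half_sqrt)
      then show "\<bar>u (y, t0) - u (y, \<tau>)\<bar> \<le> C * (t0 - \<tau>) powr (min \<alpha> 1)"
        using C[of "(y, t0)" "(y, \<tau>)"] h 1 by (simp add: dist_norm norm_minus_commute)
    qed
  next
    case 2
    then obtain D where D: "is_grad_x u D" "phoelder_mid ?K \<alpha> u D"
      using reg K unfolding phoelder_loc_def by auto
    then obtain C where C: "\<And>p q. p \<in> ?K \<Longrightarrow> q \<in> ?K \<Longrightarrow>
        (fst p = fst q \<longrightarrow> \<bar>u p - u q\<bar> \<le> C * \<bar>snd p - snd q\<bar> powr \<alpha>) \<and>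
        (snd p = snd q \<longrightarrow> norm (D p - D q) \<le> C * norm (fst p - fst q) powr (2 * \<alpha> - 1))"
      unfolding phoelder_mid_def by blast
    note D0 = is_grad_x_zero_at_max[OF D(1) max]
    show thesis
    proof (rule combine[of "\<bar>C\<bar>" C])
      fix y assume y: "norm (y - x0) \<le> 1"
      have "\<bar>u (y, t0) - u (x0, t0)\<bar> \<le> \<bar>C\<bar> * norm (y - x0) powr (2 * \<alpha>)"
      proof (rule gradient_growth[where D="\<lambda>y. D (y, t0)", OF _ _ _ y])
        fix z assume "norm (z - x0) \<le> 1"
        then have "norm (D (z, t0)) \<le> C * norm (z - x0) powr (2 * \<alpha> - 1)"
          using C[of "(z, t0)" "(x0, t0)"] D0 by (simp add: dist_norm norm_minus_commute)
        also have "\<dots> \<le> \<bar>C\<bar> * norm (z - x0) powr (2 * \<alpha> - 1)"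
          by (intro mult_right_mono) auto
        finally show "norm (D (z, t0)) \<le> \<bar>C\<bar> * norm (z - x0) powr (2 * \<alpha> - 1)" .
      qed (use D(1) 2 in \<open>auto simp: is_grad_x_def\<close>)
      then show "\<bar>u (y, t0) - u (x0, t0)\<bar> \<le> \<bar>C\<bar> * norm (y - x0) powr (2 * min \<alpha> 1)"
        using 2 by simp
    next
      fix y \<tau> assume h: "norm (y - x0) \<le> 1" "t0 - 1 \<le> \<tau>" "\<tau> \<le> t0"
      then show "\<bar>u (y, t0) - u (y, \<tau>)\<bar> \<le> C * (t0 - \<tau>) powr (min \<alpha> 1)"
        using C[of "(y, t0)" "(y, \<tau>)"] 2 by (simp add: dist_norm norm_minus_commute)
    qed
  next
    case 3
    then obtain Ut D H where
      Ut': "\<forall>x t. ((\<lambda>\<tau>. u (x, \<tau>)) has_real_derivative Ut (x, t)) (at t)"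
      and D: "is_grad_x u D"
      and H': "\<forall>x t. ((\<lambda>y. D (y, t)) has_derivative H (x, t)) (at x)"
      and low: "\<forall>K. compact K \<longrightarrow> phoelder_low K (\<alpha> - 1) Ut \<and>
                 (\<forall>i\<in>Basis. \<forall>j\<in>Basis. phoelder_low K (\<alpha> - 1) (\<lambda>p. H p i \<bullet> j))"
      using reg unfolding phoelder_loc_def by auto
    have Ut: "((\<lambda>\<tau>. u (x, \<tau>)) has_real_derivative Ut (x, t)) (at t)" for x t
      using Ut' by blast
    have H: "((\<lambda>y. D (y, t)) has_derivative H (x, t)) (at x)" for x t
      using H' by blast
    have Ulow: "phoelder_low ?K (\<alpha> - 1) Ut"
      using low K by blast
    have Hlow: "phoelder_low ?K (\<alpha> - 1) (\<lambda>p. H p i \<bullet> j)" if "i \<in> Basis" "j \<in> Basis" for i j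
      using low K that by blast
    note D0 = is_grad_x_zero_at_max[OF D max]
    obtain B where B: "B \<ge> 0"
      "\<And>y \<tau>. norm (y - x0) \<le> 1 \<Longrightarrow> t0 - 1 \<le> \<tau> \<Longrightarrow> \<tau> \<le> t0 \<Longrightarrow> \<bar>Ut (y, \<tau>)\<bar> \<le> B"
      using phoelder_low_bounded[OF Ulow] 3 by auto
    \<comment> \<open>Each entry of the second derivative has its own bound; choosing these as a
      function of \<open>i\<close> and \<open>j\<close> lets them be summed in
      \<open>A\<close>.\<close>
    define E where "E i j = (SOME B. \<forall>y. norm (y - x0) \<le> 1 \<longrightarrow> \<bar>H (y, t0) i \<bullet> j\<bar> \<le> B)" for i j
    have E: "\<bar>H (y, t0) i \<bullet> j\<bar> \<le> E i j" if "i \<in> Basis" "j \<in> Basis" "norm (y - x0) \<le> 1" for i j y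
    proof -
      have "phoelder_low ?K (\<alpha> - 1) (\<lambda>p. H p i \<bullet> j)" "\<alpha> - 1 > 0" using Hlow that 3 by simp_all
      then obtain B where "\<And>y \<tau>. norm (y - x0) \<le> 1 \<Longrightarrow> t0 - 1 \<le> \<tau> \<Longrightarrow> \<tau> \<le> t0 \<Longrightarrow> \<bar>H (y, \<tau>) i \<bullet> j\<bar> \<le> B"
        by (rule phoelder_low_bounded) blast
      then have "\<exists>B. \<forall>y. norm (y - x0) \<le> 1 \<longrightarrow> \<bar>H (y, t0) i \<bullet> j\<bar> \<le> B"
        by (intro exI[of _ B]) auto
      from someI_ex[OF this] that(3) show ?thesis
        unfolding E_def by blast
    qed
    define A where "A = (\<Sum>i\<in>Basis. \<Sum>j\<in>Basis. E i j)"
    \<comment> \<open>The bounded second derivative makes the gradient Lipschitz on the unit ball;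
      being zero at \<open>x0\<close>, it grows at most linearly.\<close>
    have Dle: "norm (D (z, t0)) \<le> A * norm (z - x0)" if z: "norm (z - x0) \<le> 1" for z
    proof -
      have "norm (D (z, t0) - D (x0, t0)) \<le> A * norm (z - x0)"
      proof (rule differentiable_bound[where S="cball x0 1" and f'="\<lambda>x. H (x, t0)"])
        fix x assume "x \<in> cball x0 1"
        then have x: "norm (x - x0) \<le> 1" by (simp add: dist_norm norm_minus_commute)
        show "((\<lambda>y. D (y, t0)) has_derivative H (x, t0)) (at x within cball x0 1)"
          using H has_derivative_at_withinI by blast
        have "linear (H (x, t0))" using H has_derivative_linear by blast
        then have "norm (H (x, t0) h) \<le> A * norm h" for h
          unfolding A_def by (rule norm_linear_le_of_entries) (use E x in auto)
        then show "onorm (H (x, t0)) \<le> A" by (rule onorm_le)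
      qed (use z in \<open>auto simp: dist_norm norm_minus_commute\<close>)
      then show ?thesis using D0 by simp
    qed
    show thesis
    proof (rule combine[of "\<bar>A\<bar>" B])
      fix y assume y: "norm (y - x0) \<le> 1"
      have "\<bar>u (y, t0) - u (x0, t0)\<bar> \<le> \<bar>A\<bar> * norm (y - x0) powr 2"
      proof (rule gradient_growth[where D="\<lambda>y. D (y, t0)", OF _ _ _ y])
        fix z assume "norm (z - x0) \<le> 1"
        then have "norm (D (z, t0)) \<le> A * norm (z - x0)" by (rule Dle)
        also have "\<dots> \<le> \<bar>A\<bar> * norm (z - x0)" by (intro mult_right_mono) auto
        finally show "norm (D (z, t0)) \<le> \<bar>A\<bar> * norm (z - x0) powr (2 - 1)" by simp
      qed (use D in \<open>auto simp: is_grad_x_def\<close>)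
      then show "\<bar>u (y, t0) - u (x0, t0)\<bar> \<le> \<bar>A\<bar> * norm (y - x0) powr (2 * min \<alpha> 1)"
        using 3 by simp
    next
      fix y \<tau> assume h: "norm (y - x0) \<le> 1" "t0 - 1 \<le> \<tau>" "\<tau> \<le> t0"
      have "norm (u (y, t0) - u (y, \<tau>)) \<le> B * norm (t0 - \<tau>)"
        by (rule field_differentiable_bound[where S="{t0 - 1..t0}" and f'="\<lambda>t. Ut (y, t)"])
           (use h B Ut in \<open>auto intro: has_field_derivative_at_within\<close>)
      then show "\<bar>u (y, t0) - u (y, \<tau>)\<bar> \<le> B * (t0 - \<tau>) powr (min \<alpha> 1)"
        using h 3 by (cases "\<tau> = t0") auto
    qed
  qed
qed

section \<open>Integrability of the defect against the heat kernel\<close>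

lemma sets_time_slab [measurable]:
  "{p. snd p < t} \<in> sets (borel :: ('a::euclidean_space \<times> real) measure)"
  by (intro borel_open open_Collect_less continuous_intros)

text \<open>Local integrability makes each cutoff of \<open>u\<close> to a ball measurable, and
  \<open>u\<close> is their pointwise limit.\<close>

lemma class_L_measurable:
  fixes u :: "'a::euclidean_space \<times> real \<Rightarrow> real"
  assumes "class_L s u"
  shows "u \<in> borel_measurable borel"
proof (rule borel_measurable_LIMSEQ_real)
  show "(\<lambda>n. indicator (cball 0 (real n)) p *\<^sub>R u p) \<longlonglongrightarrow> u p" for p
  proof (rule tendsto_eventually)
    show "\<forall>\<^sub>F n in sequentially. indicator (cball 0 (real n)) p *\<^sub>R u p = u p"
      using eventually_ge_at_top[of "nat \<lceil>norm p\<rceil>"]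
      by eventually_elim (auto simp: indicator_def nat_ceiling_le_eq)
  qed
  show "(\<lambda>p. indicator (cball 0 (real n)) p *\<^sub>R u p) \<in> borel_measurable borel" for n
  proof -
    have "compact (cball (0 :: 'a \<times> real) (real n))" by simp
    then have "set_integrable lborel (cball 0 (real n)) u"
      using assms unfolding class_L_def by blast
    then show ?thesis
      unfolding set_integrable_def by (simp add: borel_measurable_integrable flip: measurable_lborel1)
  qed
qed

lemma measurable_heat_kernel:
  "(\<lambda>p. heat_kernel n s x t (fst p) (snd p)) \<in> borel_measurable (borel :: ('a::euclidean_space \<times> real) measure)"
  unfolding heat_kernel_def borel_prod[symmetric] by measurable

text \<open>Dominated by a multiple of \<open>majorant\<close> plus a multiple of \<bar>u\<bar>
  times the weight of \<open>class_L\<close>. Close to \<open>(x0, t0)\<close> the growth bound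
  gives \<open>majorant\<close> alone; elsewhere the defect is split into the constant part, bounded
  by \<open>majorant\<close>, and the part with \<open>u\<close>, bounded by the weight.\<close>

lemma integrable_heat_kernel_defect:
  fixes u :: "'a::euclidean_space \<times> real \<Rightarrow> real"
  assumes s: "0 < s" and b: "s < b" "b \<le> 1" and L: "class_L s u" and C: "C \<ge> 0"
    and growth: "\<And>y \<tau>. norm (x0 - y) \<le> 1 \<Longrightarrow> t0 - 1 \<le> \<tau> \<Longrightarrow> \<tau> \<le> t0 \<Longrightarrow>
      \<bar>u (x0, t0) - u (y, \<tau>)\<bar> \<le> C * (norm (x0 - y) powr (2 * b) + (t0 - \<tau>) powr b)"
  shows "integrable lborel (\<lambda>p. indicator {p. snd p < t0} p *
    ((u (x0, t0) - u p) * heat_kernel DIM('a) s x0 t0 (fst p) (snd p)))"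
proof -
  note [measurable] = class_L_measurable[OF L] measurable_heat_kernel
  define M where "M = u (x0, t0)"
  define K where "K p = heat_kernel DIM('a) s x0 t0 (fst p) (snd p)" for p :: "'a \<times> real"
  define m where "m = majorant b s x0 t0"
  define w where "w p = exp (- (norm (fst p))\<^sup>2 / (4 * (t0 + 2 - snd p)))
                     / (1 + (t0 + 2 - snd p) powr (real DIM('a) / 2 + 1 + s))" for p :: "'a \<times> real"
  have [measurable]: "w \<in> borel_measurable borel"
    unfolding w_def borel_prod[symmetric] by measurable
  have w0: "w p \<ge> 0" for p unfolding w_def by (intro divide_nonneg_nonneg add_nonneg_nonneg) auto
  have m0: "m p \<ge> 0" for p by (simp add: m_def majorant_nonneg)
  have K0: "K p \<ge> 0" for p by (simp add: K_def heat_kernel_nonneg)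
  obtain C1 where C1: "C1 \<ge> 0" "\<And>y \<tau>. \<tau> < t0 \<Longrightarrow> 1 \<le> t0 - \<tau> \<or> 1 \<le> norm (x0 - y) \<Longrightarrow>
      heat_kernel DIM('a) s x0 t0 y \<tau> \<le> C1 * majorant b s x0 t0 (y, \<tau>)"
    using heat_kernel_le_majorant_far[of b 1 t0 x0 s] s b by auto
  obtain C2 where C2: "C2 \<ge> 0" "\<And>y \<tau>. \<tau> < t0 \<Longrightarrow> 1 \<le> t0 - \<tau> \<or> 1 \<le> norm (x0 - y) \<Longrightarrow>
      heat_kernel DIM('a) s x0 t0 y \<tau> \<le> C2 * (exp (- (norm y)\<^sup>2 / (4 * (t0 + 2 - \<tau>)))
                     / (1 + (t0 + 2 - \<tau>) powr (real DIM('a) / 2 + 1 + s)))"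
    using heat_kernel_le_class_weight[OF s] by blast
  define A where "A = C * ((8 powr b + 1) * 8 powr (real DIM('a) / 2))"
  have A: "A \<ge> 0" unfolding A_def using C by (intro mult_nonneg_nonneg add_nonneg_nonneg) auto
  \<comment> \<open>This is the condition of \<open>class_L\<close> at time \<open>t0 + 2\<close>;
    its domain contains the past of \<open>t0\<close>.\<close>
  have "integrable lborel (\<lambda>p. indicator {p. snd p < t0 + 2} p * (\<bar>u p\<bar> * w p))"
  proof (rule integrableI_bounded)
    have "(\<integral>\<^sup>+p. ennreal (norm (indicator {p. snd p < t0 + 2} p * (\<bar>u p\<bar> * w p))) \<partial>lborel) =
      (\<integral>\<^sup>+ p. indicator {p. snd p < t0 + 2} p * ennreal (\<bar>u p\<bar> * exp (- (norm (fst p))\<^sup>2 / (4 * (t0 + 2 - snd p)))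
         / (1 + (t0 + 2 - snd p) powr (real DIM('a) / 2 + 1 + s))) \<partial>lborel)"
      using w0 by (intro nn_integral_cong) (auto simp: indicator_def abs_mult w_def)
    also have "\<dots> < \<infinity>" using L unfolding class_L_def by blast
    finally show "(\<integral>\<^sup>+p. ennreal (norm (indicator {p. snd p < t0 + 2} p * (\<bar>u p\<bar> * w p))) \<partial>lborel) < \<infinity>" .
  qed measurable
  then have "integrable lborel (\<lambda>p. (A + \<bar>M\<bar> * C1) * m p + C2 * (indicator {p. snd p < t0 + 2} p * (\<bar>u p\<bar> * w p)))"
    using integrable_majorant[OF b(1) s, of x0 t0] unfolding m_def by auto
  then have "integrable lborel (\<lambda>p. indicator {p. snd p < t0} p * ((M - u p) * K p))"
  proof (rule Bochner_Integration.integrable_bound)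
    show "(\<lambda>p. indicator {p. snd p < t0} p * ((M - u p) * K p)) \<in> borel_measurable lborel"
      unfolding K_def by measurable
    have "norm (indicator {p. snd p < t0} (y, \<tau>) * ((M - u (y, \<tau>)) * K (y, \<tau>)))
       \<le> (A + \<bar>M\<bar> * C1) * m (y, \<tau>) + C2 * (indicator {p. snd p < t0 + 2} (y, \<tau>) * (\<bar>u (y, \<tau>)\<bar> * w (y, \<tau>)))" for y \<tau>
    proof -
      let ?p = "(y, \<tau>)"
      consider "\<not> \<tau> < t0" | "\<tau> < t0" "1 \<le> t0 - \<tau> \<or> 1 \<le> norm (x0 - y)" | "\<tau> < t0" "t0 - \<tau> < 1" "norm (x0 - y) < 1"
        by linarith
      then show ?thesis
      proof cases
        case 1
        then show ?thesis using A m0 w0 C1 C2 by simp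
      next
        case 2
        have "\<bar>M - u ?p\<bar> * K ?p \<le> \<bar>M\<bar> * K ?p + \<bar>u ?p\<bar> * K ?p"
          unfolding distrib_right[symmetric] using K0 by (intro mult_right_mono abs_triangle_ineq4) auto
        also have "\<dots> \<le> \<bar>M\<bar> * (C1 * m ?p) + \<bar>u ?p\<bar> * (C2 * w ?p)"
          using C1(2)[OF 2] C2(2)[OF 2] by (intro add_mono mult_left_mono) (auto simp: K_def m_def w_def)
        also have "\<dots> \<le> (A * m ?p + \<bar>M\<bar> * (C1 * m ?p)) + \<bar>u ?p\<bar> * (C2 * w ?p)"
          using A m0 by simp
        also have "\<dots> = (A + \<bar>M\<bar> * C1) * m ?p + C2 * (\<bar>u ?p\<bar> * w ?p)"
          by (simp add: algebra_simps)
        finally show ?thesis using 2 K0 by (simp add: abs_mult)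
      next
        case 3
        have "\<bar>M - u ?p\<bar> * K ?p \<le> C * (norm (x0 - y) powr (2 * b) + (t0 - \<tau>) powr b) * K ?p"
          using growth[of y \<tau>] 3 K0 by (intro mult_right_mono) (auto simp: M_def)
        also have "\<dots> = C * ((norm (x0 - y) powr (2 * b) + (t0 - \<tau>) powr b) * K ?p)" by simp
        also have "\<dots> \<le> C * ((8 powr b + 1) * 8 powr (real DIM('a) / 2) * m ?p)"
          unfolding K_def m_def fst_conv snd_conv using 3 b s C
          by (intro mult_left_mono growth_heat_kernel_le_majorant) auto
        also have "\<dots> = A * m ?p" by (simp add: A_def)
        also have "\<dots> \<le> (A + \<bar>M\<bar> * C1) * m ?p + C2 * (\<bar>u ?p\<bar> * w ?p)"
          using C1(1) C2(1) m0 w0 by (simp add: distrib_right)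
        finally show ?thesis using 3 K0 by (simp add: abs_mult)
      qed
    qed
    then have "norm (indicator {p. snd p < t0} p * ((M - u p) * K p))
       \<le> norm ((A + \<bar>M\<bar> * C1) * m p + C2 * (indicator {p. snd p < t0 + 2} p * (\<bar>u p\<bar> * w p)))" for p
      unfolding real_norm_def by (cases p) (blast intro: order_trans abs_ge_self)
    then show "AE p in lborel. norm (indicator {p. snd p < t0} p * ((M - u p) * K p))
       \<le> norm ((A + \<bar>M\<bar> * C1) * m p + C2 * (indicator {p. snd p < t0 + 2} p * (\<bar>u p\<bar> * w p)))"
      by (rule AE_I2)
  qed
  then show ?thesis unfolding M_def K_def .
qed

section \<open>The exterior region and the constant \<open>C0\<close>\<close>

text \<open>All points of the region are at distance at least \<open>r\<close> from
  \<open>x\<close>, so the far bound applies with \<open>\<rho> = r\<close>; the exponent b = 1 is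
  admissible because s < 1.\<close>

lemma integrable_heat_kernel_exterior:
  fixes x :: "'a::euclidean_space"
  assumes s: "0 < s" "s < 1" and r: "0 < r"
  shows "integrable lborel (\<lambda>p. indicator ((- ball x r) \<times> {..<t - r\<^sup>2}) p * heat_kernel DIM('a) s x t (fst p) (snd p))"
proof -
  obtain C where C: "C \<ge> 0" "\<And>y \<tau>. \<tau> < t \<Longrightarrow> 1 \<le> t - \<tau> \<or> r \<le> norm (x - y) \<Longrightarrow>
      heat_kernel DIM('a) s x t y \<tau> \<le> C * majorant 1 s x t (y, \<tau>)"
    using heat_kernel_le_majorant_far[of 1 r t x s] r by auto
  note [measurable] = measurable_heat_kernel
  have "integrable lborel (\<lambda>p. C * majorant 1 s x t p)"
    using integrable_majorant[OF s(2) s(1)] by auto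
  then show ?thesis
  proof (rule Bochner_Integration.integrable_bound)
    show "AE p in lborel. norm (indicator ((- ball x r) \<times> {..<t - r\<^sup>2}) p * heat_kernel DIM('a) s x t (fst p) (snd p))
        \<le> norm (C * majorant 1 s x t p)"
    proof (intro AE_I2)
      fix p :: "'a \<times> real"
      obtain y \<tau> where p: "p = (y, \<tau>)" by fastforce
      have "\<tau> < t" if "\<tau> < t - r\<^sup>2" using that by (smt (verit) zero_le_power2)
      then show "norm (indicator ((- ball x r) \<times> {..<t - r\<^sup>2}) p * heat_kernel DIM('a) s x t (fst p) (snd p))
        \<le> norm (C * majorant 1 s x t p)"
        using C(2)[of \<tau> y] C(1) by (auto simp: p indicator_def dist_norm heat_kernel_nonneg majorant_nonneg)
    qed
    have "(- ball x r) \<times> {..<t - r\<^sup>2} \<in> sets (borel \<Otimes>\<^sub>M borel)"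
      by (rule pair_measureI) auto
    then have [measurable]: "(- ball x r) \<times> {..<t - r\<^sup>2} \<in> sets borel"
      unfolding borel_prod .
    show "(\<lambda>p. indicator ((- ball x r) \<times> {..<t - r\<^sup>2}) p * heat_kernel DIM('a) s x t (fst p) (snd p)) \<in> borel_measurable lborel"
      by measurable
  qed
qed

text \<open>Fubini with time outermost, the order used in \<open>frac_heat\<close> and
  \<open>C0\<close>. All comparisons can then be made between integrals over space-time.\<close>

lemma nested_integral_eq_product:
  fixes g :: "'a::euclidean_space \<times> real \<Rightarrow> real"
  assumes "integrable lborel (\<lambda>p. indicator (S \<times> T) p * g p)"
  shows "(LINT \<tau>:T|lborel. (LINT y:S|lborel. g (y, \<tau>))) = (LINT p|lborel. indicator (S \<times> T) p * g p)"
proof -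
  have int: "integrable (lborel \<Otimes>\<^sub>M lborel) (\<lambda>(y, \<tau>). indicator (S \<times> T) (y, \<tau>) * g (y, \<tau>))"
    using assms unfolding lborel_prod by (simp add: case_prod_beta')
  have "(LINT \<tau>:T|lborel. (LINT y:S|lborel. g (y, \<tau>)))
     = (LINT \<tau>|lborel. (LINT y|lborel. indicator (S \<times> T) (y, \<tau>) * g (y, \<tau>)))"
    unfolding set_lebesgue_integral_def
    by (intro Bochner_Integration.integral_cong refl)
       (simp add: indicator_times mult.commute[of "indicator S _"] mult.assoc)
  also have "\<dots> = integral\<^sup>L (lborel \<Otimes>\<^sub>M lborel) (\<lambda>(y, \<tau>). indicator (S \<times> T) (y, \<tau>) * g (y, \<tau>))"
    by (rule lborel_pair.integral_snd[OF int])
  also have "\<dots> = (LINT p|lborel. indicator (S \<times> T) p * g p)"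
    unfolding lborel_prod by (simp add: case_prod_beta')
  finally show ?thesis .
qed

text \<open>Substitute \<open>y = x + r *\<^sub>R z\<close> and
  \<open>\<tau> = t + r\<^sup>2 * \<rho>\<close>. The Jacobian has degree n + 2 in r and the kernel
  contributes degree -2a with a = n/2 + 1 + s, which leaves -2s.\<close>

lemma exterior_integral_scaling:
  fixes x :: "'a::euclidean_space"
  assumes r: "0 < r"
  shows "(LINT \<tau>:{..<t - r\<^sup>2}|lborel. (LINT y:- ball x r|lborel. heat_kernel DIM('a) s x t y \<tau>))
    = r powr (- 2 * s) * (LINT \<tau>:{..<-1}|lborel. (LINT (y::'a):- ball 0 1|lborel.
        exp ((norm y)\<^sup>2 / (4 * \<tau>)) / (- \<tau>) powr (real DIM('a) / 2 + 1 + s)))"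
    (is "?lhs = _ * (LINT \<tau>:{..<-1}|lborel. ?in \<tau>)")
proof -
  define a where "a = real DIM('a) / 2 + 1 + s"
  have ball: "indicator (- ball x r) (x + r *\<^sub>R z) = (indicator (- ball 0 1) z :: real)" for z :: 'a
    using r by (auto simp: indicator_def dist_norm mult_le_cancel_left1)
  have kernel: "heat_kernel DIM('a) s x t (x + r *\<^sub>R z) (t + r\<^sup>2 * \<rho>)
     = r powr (- 2 * a) * (exp ((norm z)\<^sup>2 / (4 * \<rho>)) / (- \<rho>) powr a)" if "\<rho> < 0" for z \<rho>
  proof -
    have "(r\<^sup>2 * (- \<rho>)) powr a = r powr (2 * a) * (- \<rho>) powr a"
      using r that powr_powr[of r 2 a] by (subst powr_mult) auto
    moreover have "- (norm (x - (x + r *\<^sub>R z)))\<^sup>2 / (4 * (t - (t + r\<^sup>2 * \<rho>))) = (norm z)\<^sup>2 / (4 * \<rho>)"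
      using r by (simp add: power_mult_distrib)
    moreover have "t - (t + r\<^sup>2 * \<rho>) = r\<^sup>2 * (- \<rho>)" by simp
    moreover have "r powr (- 2 * a) = 1 / r powr (2 * a)"
      by (simp add: powr_minus_divide)
    ultimately show ?thesis
      unfolding heat_kernel_def a_def[symmetric] by simp
  qed
  have inner: "(LINT y:- ball x r|lborel. heat_kernel DIM('a) s x t y (t + r\<^sup>2 * \<rho>))
      = r ^ DIM('a) * r powr (- 2 * a) * ?in \<rho>" if "\<rho> < 0" for \<rho>
  proof -
    have "(LINT y:- ball x r|lborel. heat_kernel DIM('a) s x t y (t + r\<^sup>2 * \<rho>))
      = r ^ DIM('a) * (LINT z|lborel. indicator (- ball x r) (x + r *\<^sub>R z) *\<^sub>R heat_kernel DIM('a) s x t (x + r *\<^sub>R z) (t + r\<^sup>2 * \<rho>))"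
      unfolding set_lebesgue_integral_def using r
      by (subst lebesgue_integral_lborel_affine[where c=r and t=x]) (auto simp: heat_kernel_def)
    also have "\<dots> = r ^ DIM('a) * (LINT z::'a|lborel. r powr (- 2 * a) * (indicator (- ball 0 1) z *\<^sub>R (exp ((norm z)\<^sup>2 / (4 * \<rho>)) / (- \<rho>) powr a)))"
      unfolding ball kernel[OF that] by (simp add: mult.left_commute)
    also have "\<dots> = r ^ DIM('a) * r powr (- 2 * a) * ?in \<rho>"
      unfolding set_lebesgue_integral_def a_def by simp
    finally show ?thesis .
  qed
  have ind: "indicator {..<t - r\<^sup>2} (t + r\<^sup>2 * \<rho>) = (indicator {..<-1} \<rho> :: real)" for \<rho>
  proof -
    have "r\<^sup>2 * \<rho> < - (r\<^sup>2) \<longleftrightarrow> \<rho> < -1"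
      using r mult_less_cancel_left_pos[of "r\<^sup>2" \<rho> "-1"] by simp
    then show ?thesis by (auto simp: indicator_def)
  qed
  have "?lhs = r\<^sup>2 * (LINT \<rho>|lborel. indicator {..<-1} \<rho> *
      (LINT y:- ball x r|lborel. heat_kernel DIM('a) s x t y (t + r\<^sup>2 * \<rho>)))"
    unfolding set_lebesgue_integral_def[of _ "{..<t - r\<^sup>2}"] using r
    by (subst lborel_integral_real_affine[where c="r\<^sup>2" and t=t]) (auto simp: ind)
  also have "\<dots> = r\<^sup>2 * (LINT \<rho>|lborel. (r ^ DIM('a) * r powr (- 2 * a)) * (indicator {..<-1} \<rho> * ?in \<rho>))"
  proof -
    have "indicator {..<-1} \<rho> * (LINT y:- ball x r|lborel. heat_kernel DIM('a) s x t y (t + r\<^sup>2 * \<rho>))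
        = (r ^ DIM('a) * r powr (- 2 * a)) * (indicator {..<-1} \<rho> * ?in \<rho>)" for \<rho>
      by (cases "\<rho> < -1") (simp_all add: inner)
    then show ?thesis by (simp only:)
  qed
  also have "\<dots> = (r\<^sup>2 * r ^ DIM('a) * r powr (- 2 * a)) * (LINT \<tau>:{..<-1}|lborel. ?in \<tau>)"
    by (simp only: set_lebesgue_integral_def[of _ "{..<-1}"] integral_mult_right_zero real_scaleR_def mult.assoc)
  also have "r\<^sup>2 * r ^ DIM('a) * r powr (- 2 * a) = r powr (2 + real DIM('a) + - 2 * a)"
    using r unfolding powr_add by (simp add: powr_realpow)
  also have "2 + real DIM('a) + - 2 * a = - 2 * s" by (simp add: a_def)
  finally show ?thesis .
qed

text \<open>The integrand is the heat kernel with pole at the origin, strictly positive on its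
  region, so a zero integral would make a nonempty open set null. Positivity ensures that the
  \<open>inverse\<close> in \<open>C0\<close> is a genuine reciprocal rather than the default value
  0.\<close>

lemma exterior_integral_pos:
  assumes s: "0 < s" "s < 1"
  shows "0 < (LINT \<tau>:{..<-1}|lborel. (LINT (y::'a::euclidean_space):- ball 0 1|lborel.
        exp ((norm y)\<^sup>2 / (4 * \<tau>)) / (- \<tau>) powr (real DIM('a) / 2 + 1 + s)))" (is "0 < ?I")
proof -
  let ?S = "(- ball (0::'a) 1) \<times> {..<-1 :: real}"
  let ?K = "\<lambda>p. heat_kernel DIM('a) s (0::'a) 0 (fst p) (snd p)"
  let ?f = "\<lambda>p. indicator ?S p * ?K p"
  have int: "integrable lborel ?f"
    using integrable_heat_kernel_exterior[OF s, where r=1 and t=0 and x="0::'a"] by simp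
  have "?I = (LINT \<tau>:{..<-1}|lborel. (LINT y:- ball 0 1|lborel. ?K (y, \<tau>)))"
    by (simp add: heat_kernel_def)
  also have "\<dots> = (LINT p|lborel. ?f p)"
    by (rule nested_integral_eq_product[OF int])
  finally have I: "?I = (LINT p|lborel. ?f p)" .
  have f0: "0 \<le> ?f p" for p by (simp add: heat_kernel_nonneg)
  have "(LINT p|lborel. ?f p) \<noteq> 0"
  proof
    assume "(LINT p|lborel. ?f p) = 0"
    then have AE: "AE p in lborel. ?f p = 0"
      using integral_nonneg_eq_0_iff_AE[OF int] f0 by simp
    \<comment> \<open>The complement of the open ball is closed; the strict inequality selects an
      open part of the region.\<close>
    let ?O = "{p :: 'a \<times> real. 1 < norm (fst p)} \<inter> {p. snd p < -1}"
    have O: "open ?O" by (intro open_Int open_Collect_less continuous_intros)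
    have "AE p in lborel. p \<notin> ?O"
      using AE
    proof eventually_elim
      case (elim p)
      then show ?case by (auto simp: indicator_def heat_kernel_def mem_Times_iff split: if_splits)
    qed
    then have "?O \<in> null_sets lborel"
      using O by (subst AE_iff_null_sets) auto
    then have "negligible ?O"
      unfolding negligible_iff_null_sets by (rule null_sets_completionI)
    moreover obtain b :: 'a where "b \<in> Basis" using nonempty_Basis by blast
    then have "(2 *\<^sub>R b, -2) \<in> ?O" by simp
    ultimately show False using open_not_negligible[OF O] by blast
  qed
  moreover have "0 \<le> (LINT p|lborel. ?f p)" using f0 by (intro integral_nonneg_AE AE_I2)
  ultimately show ?thesis unfolding I by simp
qed

lemma C0_exterior_integral:
  fixes x :: "'a::euclidean_space"
  assumes s: "0 < s" "s < 1" and r: "0 < r"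
  shows "C0 DIM('a) s TYPE('a) * r powr (2 * s) *
            (LINT \<tau>:{..<t - r\<^sup>2}|lborel. (LINT y:- ball x r|lborel.
                heat_kernel DIM('a) s x t y \<tau>)) = 1"
proof -
  have inverse: "inverse I * R * (inverse R * I) = 1" if "0 < I" "0 < R" for I R :: real
    using that by (simp add: field_simps)
  have "r powr (- 2 * s) = inverse (r powr (2 * s))" by (simp add: powr_minus)
  then show ?thesis
    unfolding C0_def exterior_integral_scaling[OF r]
    using inverse[OF exterior_integral_pos[OF s, where 'a='a], of "r powr (2 * s)"] r by simp
qed

section \<open>Time truncations and the estimate at the maximum\<close>

lemma truncated_integral_tendsto:
  fixes f :: "'a::euclidean_space \<times> real \<Rightarrow> real"
  assumes f: "integrable lborel f" and zero: "\<And>p. \<not> snd p < t \<Longrightarrow> f p = 0"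
  shows "((\<lambda>\<delta>. LINT p|lborel. indicator {p. snd p < t - \<delta>} p * f p) \<longlongrightarrow> (LINT p|lborel. f p)) (at_right 0)"
\<comment> \<open>Dominated convergence is sequential, so the one-sided limit is tested on
  sequences. For each point the cutoff is eventually inactive, and \<open>norm (f p)\<close>
  dominates.\<close>
proof (rule tendsto_at_right_sequentially[of 0 1])
  fix S :: "nat \<Rightarrow> real"
  assume S: "\<And>n. 0 < S n" "S \<longlonglongrightarrow> 0"
  note [measurable] = borel_measurable_integrable[OF f]
  show "(\<lambda>n. LINT p|lborel. indicator {p. snd p < t - S n} p * f p) \<longlonglongrightarrow> (LINT p|lborel. f p)"
  proof (rule integral_dominated_convergence[where w="\<lambda>p. norm (f p)"])
    show "AE p in lborel. (\<lambda>n. indicator {p. snd p < t - S n} p * f p) \<longlonglongrightarrow> f p"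
    proof (intro AE_I2 tendsto_eventually)
      fix p :: "'a \<times> real"
      show "\<forall>\<^sub>F n in sequentially. indicator {p. snd p < t - S n} p * f p = f p"
      proof (cases "snd p < t")
        case True
        then have "\<forall>\<^sub>F n in sequentially. S n < t - snd p"
          using order_tendstoD(2)[OF S(2), of "t - snd p"] by simp
        then show ?thesis by eventually_elim (auto simp: indicator_def)
      qed (simp add: zero)
    qed
    show "integrable lborel (\<lambda>p. norm (f p))" using f by simp
    show "AE p in lborel. norm (indicator {p. snd p < t - S n} p * f p) \<le> norm (f p)" for n
      by (intro AE_I2) (simp add: indicator_def)
  qed measurable
qed simp

text \<open>In HOL \<open>Gamma\<close> takes the value 0 exactly at its poles, the nonpositive
  integers, and -s lies strictly between -1 and 0.\<close>

lemma Cns_pos: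
  assumes "0 < s" "s < 1"
  shows "0 < Cns n s"
proof -
  have "- s \<notin> \<int>\<^sub>\<le>\<^sub>0"
  proof
    assume "- s \<in> \<int>\<^sub>\<le>\<^sub>0"
    then obtain k :: nat where "- s = - real k" by (auto elim: nonpos_Ints_cases')
    then show False using assms by (cases k) auto
  qed
  then show ?thesis by (simp add: Cns_def Gamma_eq_zero_iff)
qed

theorem theorem1p2:
  fixes u :: "'a::euclidean_space \<times> real \<Rightarrow> real" and s \<epsilon> r t0 :: real and x0 :: 'a
  assumes "0 < s" "s < 1" "0 < \<epsilon>" "\<epsilon> < 1"
    and "phoelder_loc (s + \<epsilon> / 2) u" and "class_L s u"
    and "\<forall>y \<tau>. \<tau> \<le> t0 \<longrightarrow> u (y, \<tau>) \<le> u (x0, t0)"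
    and "0 < r"
  shows "u (x0, t0) \<le> C0 DIM('a) s TYPE('a) / Cns DIM('a) s * r powr (2 * s) * frac_heat s u x0 t0
          + C0 DIM('a) s TYPE('a) * r powr (2 * s) *
            (LINT \<tau>:{..<t0 - r\<^sup>2}|lborel. (LINT y:- ball x0 r|lborel.
                u (y, \<tau>) * heat_kernel DIM('a) s x0 t0 y \<tau>))
       \<and> C0 DIM('a) s TYPE('a) * r powr (2 * s) *
            (LINT \<tau>:{..<t0 - r\<^sup>2}|lborel. (LINT y:- ball x0 r|lborel.
                heat_kernel DIM('a) s x0 t0 y \<tau>)) = 1"
proof
  note s = \<open>0 < s\<close> \<open>s < 1\<close> and r = \<open>0 < r\<close> and max = assms(7)
  \<comment> \<open>The growth order exceeds s, which makes the singularity integrable; the cap at 1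
    is that of \<open>phoelder_loc_growth_at_max\<close>.\<close>
  define b where "b = min (s + \<epsilon> / 2) 1"
  have b: "s < b" "b \<le> 1" using s \<open>0 < \<epsilon>\<close> by (auto simp: b_def)
  obtain C where C: "C \<ge> 0" "\<And>y \<tau>. norm (x0 - y) \<le> 1 \<Longrightarrow> t0 - 1 \<le> \<tau> \<Longrightarrow> \<tau> \<le> t0 \<Longrightarrow>
      \<bar>u (x0, t0) - u (y, \<tau>)\<bar> \<le> C * (norm (x0 - y) powr (2 * b) + (t0 - \<tau>) powr b)"
    unfolding b_def using phoelder_loc_growth_at_max[OF assms(5) _ max] s \<open>0 < \<epsilon>\<close> by auto
  define K where "K p = heat_kernel DIM('a) s x0 t0 (fst p) (snd p)" for p
  define g where "g p = (u (x0, t0) - u p) * K p" for p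
  define f where "f p = indicator {p. snd p < t0} p * g p" for p
  define A where "A = (- ball x0 r) \<times> {..<t0 - r\<^sup>2}"
  define c where "c = C0 DIM('a) s TYPE('a) * r powr (2 * s)"
  have A_past: "snd p < t0" if "p \<in> A" for p
    using that r by (auto simp: A_def intro: less_trans[of _ "t0 - r\<^sup>2"])
  have f: "integrable lborel f"
    using integrable_heat_kernel_defect[OF s(1) b assms(6) C] unfolding f_def g_def K_def .
  \<comment> \<open>The maximality is used here; it concerns only times up to \<open>t0\<close>, and
    the indicator in \<open>f\<close> removes the rest.\<close>
  have f_nonneg: "0 \<le> f p" for p
    using max by (cases p) (auto simp: f_def g_def K_def indicator_def heat_kernel_nonneg)
  have K: "integrable lborel (\<lambda>p. indicator A p * K p)"
    using integrable_heat_kernel_exterior[OF s r] unfolding K_def A_def .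
  have "A \<in> sets (borel \<Otimes>\<^sub>M borel)" unfolding A_def by (rule pair_measureI) auto
  then have A_sets: "A \<in> sets lborel" unfolding borel_prod by simp
  have Af: "integrable lborel (\<lambda>p. indicator A p * f p)"
    using integrable_mult_indicator[OF A_sets f] by simp
  \<comment> \<open>The region \<open>A\<close> lies in the past of \<open>t0\<close>, so there u K
    is the maximum times K minus the defect; its integrability follows from that of the two
    terms.\<close>
  have split: "indicator A p * (u p * K p) = u (x0, t0) * (indicator A p * K p) - indicator A p * f p" for p
    using A_past[of p] by (auto simp: f_def g_def indicator_def algebra_simps)
  have Au: "integrable lborel (\<lambda>p. indicator A p * (u p * K p))"
    unfolding split using K Af by auto

  have one: "c * (LINT p|lborel. indicator A p * K p) = 1"
    using C0_exterior_integral[OF s r, of t0 x0] nested_integral_eq_product[OF K[unfolded A_def]]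
    by (simp add: c_def A_def K_def)
  show "C0 DIM('a) s TYPE('a) * r powr (2 * s) *
            (LINT \<tau>:{..<t0 - r\<^sup>2}|lborel. (LINT y:- ball x0 r|lborel.
                heat_kernel DIM('a) s x0 t0 y \<tau>)) = 1"
    by (rule C0_exterior_integral[OF s r])
  have u_ext: "(LINT \<tau>:{..<t0 - r\<^sup>2}|lborel. (LINT y:- ball x0 r|lborel.
      u (y, \<tau>) * heat_kernel DIM('a) s x0 t0 y \<tau>)) = (LINT p|lborel. indicator A p * (u p * K p))"
    using nested_integral_eq_product[OF Au[unfolded A_def]] by (simp add: A_def K_def)

  \<comment> \<open>For \<delta> > 0 the truncated region lies inside the past of \<open>t0\<close>,
    so \<open>g\<close> may be replaced by the integrable \<open>f\<close> and Fubini
    applies.\<close>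
  have trunc: "(LINT \<tau>:{..<t0 - \<delta>}|lborel. (LINT y|lborel. (u (x0, t0) - u (y, \<tau>)) * heat_kernel DIM('a) s x0 t0 y \<tau>))
      = (LINT p|lborel. indicator {p. snd p < t0 - \<delta>} p * f p)" if "\<delta> > 0" for \<delta>
  proof -
    have eq: "indicator (UNIV \<times> {..<t0 - \<delta>}) p * g p = indicator {p. snd p < t0 - \<delta>} p * f p" for p
      using that by (auto simp: f_def indicator_def mem_Times_iff)
    have "integrable lborel (\<lambda>p. indicator {p. snd p < t0 - \<delta>} p *\<^sub>R f p)"
      by (rule integrable_mult_indicator[OF _ f]) (use sets_time_slab in simp)
    then have "integrable lborel (\<lambda>p. indicator (UNIV \<times> {..<t0 - \<delta>}) p * g p)"
      unfolding eq by simp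
    from nested_integral_eq_product[OF this] show ?thesis
      unfolding eq by (simp add: g_def K_def set_lebesgue_integral_def)
  qed
  have "((\<lambda>\<delta>. LINT p|lborel. indicator {p. snd p < t0 - \<delta>} p * f p) \<longlongrightarrow> (LINT p|lborel. f p)) (at_right 0)"
    by (rule truncated_integral_tendsto[OF f]) (simp add: f_def)
  then have "((\<lambda>\<delta>. LINT \<tau>:{..<t0 - \<delta>}|lborel.
        (LINT y|lborel. (u (x0, t0) - u (y, \<tau>)) * heat_kernel DIM('a) s x0 t0 y \<tau>))
      \<longlongrightarrow> (LINT p|lborel. f p)) (at_right 0)"
    by (rule Lim_transform_eventually) (auto simp: eventually_at_right_less trunc intro: eventually_mono[OF eventually_at_right_less])
  \<comment> \<open>As the truncations converge, \<open>Lim\<close> is their actual limit, and the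
    operator is an absolutely convergent integral.\<close>
  then have fh: "frac_heat s u x0 t0 = Cns DIM('a) s * (LINT p|lborel. f p)"
    unfolding frac_heat_def by (subst tendsto_Lim) auto

  have "(LINT p|lborel. indicator A p * f p) \<le> (LINT p|lborel. f p)"
    using Af f by (rule integral_mono) (simp add: indicator_def f_nonneg)
  moreover have "(LINT p|lborel. indicator A p * (u p * K p))
      = u (x0, t0) * (LINT p|lborel. indicator A p * K p) - (LINT p|lborel. indicator A p * f p)"
    unfolding split using K Af by simp
  ultimately have le: "u (x0, t0) * (LINT p|lborel. indicator A p * K p)
      \<le> (LINT p|lborel. f p) + (LINT p|lborel. indicator A p * (u p * K p))" by linarith
  \<comment> \<open>The sign of \<open>c\<close> is read off from \<open>one\<close>: its product
    with a nonnegative integral is 1.\<close>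
  have "0 \<le> (LINT p|lborel. indicator A p * K p)"
    by (intro integral_nonneg_AE AE_I2) (simp add: K_def heat_kernel_nonneg)
  with one have c: "0 \<le> c" by (metis mult_nonpos_nonneg linorder_le_cases not_one_le_zero)
  have "u (x0, t0) = c * (u (x0, t0) * (LINT p|lborel. indicator A p * K p))"
    using one by (simp add: mult.left_commute)
  also have "\<dots> \<le> c * ((LINT p|lborel. f p) + (LINT p|lborel. indicator A p * (u p * K p)))"
    using le c by (rule mult_left_mono)
  also have "\<dots> = C0 DIM('a) s TYPE('a) / Cns DIM('a) s * r powr (2 * s) * frac_heat s u x0 t0
      + c * (LINT p|lborel. indicator A p * (u p * K p))"
    using Cns_pos[OF s, of "DIM('a)"] by (simp add: fh c_def distrib_left)
  finally show "u (x0, t0) \<le> C0 DIM('a) s TYPE('a) / Cns DIM('a) s * r powr (2 * s) * frac_heat s u x0 t0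
          + C0 DIM('a) s TYPE('a) * r powr (2 * s) *
            (LINT \<tau>:{..<t0 - r\<^sup>2}|lborel. (LINT y:- ball x0 r|lborel.
                u (y, \<tau>) * heat_kernel DIM('a) s x0 t0 y \<tau>))"
    unfolding u_ext c_def .
qed

end
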